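(* Consider the facility location problem on a random shortest path metric on $n$ vertices with opening costs $0<f_1\le f_2\le\dots\le f_n$ (which may depend on $n$), and assume there is a constant $q$ with $f_n/f_1\le n^q$ for all $n$. Define $\kappa:=\kappa(n;f_1,\ldots,f_n)=\max\{i\in[n]: f_i<1/(i-1)\}$ and assume that $\kappa\in o(n)$. Let $\mathsf{ALG}$ denote the total cost of the solution which opens, independently of the metric, the $\kappa$ cheapest facilities (i.e. the facilities with opening costs $f_1,\ldots,f_\kappa$), and let $\mathsf{OPT}$ be the optimal cost. Then $$\mathbb{E}\left[\frac{\mathsf{ALG}}{\mathsf{OPT}}\right]=1+o(1)\quad\text{as } n\to\infty.$$
   Context: Random shortest path metric: let $G=(V,E)$ be the complete undirected graph on $n$ vertices; each edge $e$ independently receives a weight $w(e)\sim\mathrm{Exp}(1)$ (exponential distribution with rate $1$), and $d(u,v)$ is the minimum total weight of a $u$-$v$ path in $G$. Facility location: vertex $i\in V=[n]$ has opening cost $f_i>0$, the costs are deterministic (independent of the edge weights) and numbered so that $f_1\le\dots\le f_n$. For nonempty $U\subseteq V$, $c(U)=\sum_{i\in U}f_i+\sum_{v\in V}\min_{u\in U}d(u,v)$, and $\mathsf{OPT}=\min_{\emptyset\ne U\subseteq V}c(U)$. In the definition of $\kappa$, $1/(i-1)$ for $i=1$ is interpreted as $+\infty$, so $\kappa\ge1$. $\mathsf{ALG}=c(\{1,\ldots,\kappa\})$. Asymptotic notation refers to $n\to\infty$, where the opening costs are allowed to depend on $n$. *)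

theory Defs
  imports "HOL-Probability.Probability" "HOL-Library.Landau_Symbols"
begin

text \<open>Vertices of the complete graph K_n are 1..n; the undirected edge {i,j} with i<j
  is encoded as the pair (i,j). A weight assignment is w :: nat \<times> nat \<Rightarrow> real.\<close>

definition edges :: "nat \<Rightarrow> (nat \<times> nat) set" where
  "edges n = {(i, j). 1 \<le> i \<and> i < j \<and> j \<le> n}"

definition edge_weight :: "(nat \<times> nat \<Rightarrow> real) \<Rightarrow> nat \<Rightarrow> nat \<Rightarrow> real" where
  "edge_weight w u v = w (min u v, max u v)"

definition weight_space :: "nat \<Rightarrow> (nat \<times> nat \<Rightarrow> real) measure" where
  "weight_space n = PiM (edges n) (\<lambda>_. density lborel (exponential_density 1))"

fun path_weight :: "(nat \<times> nat \<Rightarrow> real) \<Rightarrow> nat list \<Rightarrow> real" where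
  "path_weight w (x # y # p) = edge_weight w x y + path_weight w (y # p)"
| "path_weight w _ = 0"

text \<open>Simple u-v paths in K_n (since weights are nonnegative, shortest paths may be taken simple).\<close>
definition paths :: "nat \<Rightarrow> nat \<Rightarrow> nat \<Rightarrow> nat list set" where
  "paths n u v = {p. p \<noteq> [] \<and> hd p = u \<and> last p = v \<and> distinct p \<and> set p \<subseteq> {1..n}}"

definition dist_sp :: "nat \<Rightarrow> (nat \<times> nat \<Rightarrow> real) \<Rightarrow> nat \<Rightarrow> nat \<Rightarrow> real" where
  "dist_sp n w u v = Min (path_weight w ` paths n u v)"

definition fl_cost :: "nat \<Rightarrow> (nat \<Rightarrow> real) \<Rightarrow> (nat \<times> nat \<Rightarrow> real) \<Rightarrow> nat set \<Rightarrow> real" where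
  "fl_cost n f w U = (\<Sum>i\<in>U. f i) + (\<Sum>v\<in>{1..n}. Min ((\<lambda>u. dist_sp n w u v) ` U))"

definition fl_opt :: "nat \<Rightarrow> (nat \<Rightarrow> real) \<Rightarrow> (nat \<times> nat \<Rightarrow> real) \<Rightarrow> real" where
  "fl_opt n f w = Min (fl_cost n f w ` {U. U \<subseteq> {1..n} \<and> U \<noteq> {}})"

text \<open>kappa = max{i in [n] : f_i < 1/(i-1)}, with 1/(1-1) read as +infinity.\<close>
definition kappa :: "nat \<Rightarrow> (nat \<Rightarrow> real) \<Rightarrow> nat" where
  "kappa n f = Max {i \<in> {1..n}. i = 1 \<or> f i < 1 / real (i - 1)}"

definition fl_alg :: "nat \<Rightarrow> (nat \<Rightarrow> real) \<Rightarrow> (nat \<times> nat \<Rightarrow> real) \<Rightarrow> real" where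
  "fl_alg n f w = fl_cost n f w {1..kappa n f}"

end

theory Submission
  imports Defs
begin

text \<open>
  Let \<open>D(U)\<close> be the connection cost of a set \<open>U\<close> of \<open>k\<close> facilities. Growing the ball around \<open>U\<close>
  and using memorylessness of the edge weights, \<open>D(U)\<close> is distributed as a sum of independent
  exponential variables with rates \<open>k, ..., n - 1\<close>; its exponential moments are therefore
  bounded by \<open>\<Prod>i=k..n-1. i / (i + t)\<close>.

  With \<open>t = -1/2\<close> this shows that the expected cost of the algorithm is at most \<open>M + 4\<close>, where
  \<open>M = f 1 + ... + f \<kappa> + ln (n / \<kappa>)\<close> tends to infinity because \<open>\<kappa> = o(n)\<close>. With \<open>t = C k\<close> for a
  large constant \<open>C\<close>, Markov's inequality and a union bound over the at most \<open>exp (k (1 + ln (n / k)))\<close>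
  sets of size \<open>k\<close> show that, outside an event whose probability is smaller than any given power of
  \<open>1 / n\<close>, all \<open>U\<close> with \<open>k \<le> \<delta> n\<close> satisfy \<open>D(U) \<ge> (1 - \<epsilon>) ln (n / k)\<close>. The choice of \<open>\<kappa>\<close> then gives
  \<open>OPT \<ge> (1 - 2 \<epsilon>) M\<close>. On the exceptional event the ratio is at most polynomially large times
  \<open>1 + D\<close>, by the bound on \<open>f n / f 1\<close>, so its contribution vanishes.
\<close>

section \<open>Distances to a set of vertices\<close>

definition set_dist :: "nat \<Rightarrow> (nat \<times> nat \<Rightarrow> real) \<Rightarrow> nat set \<Rightarrow> nat \<Rightarrow> real" where
  "set_dist n w U v = Min ((\<lambda>u. dist_sp n w u v) ` U)"

definition conn_cost :: "nat \<Rightarrow> (nat \<times> nat \<Rightarrow> real) \<Rightarrow> nat set \<Rightarrow> real" where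
  "conn_cost n w U = (\<Sum>v\<in>{1..n}. set_dist n w U v)"

lemma fl_cost_conn: "fl_cost n f w U = (\<Sum>i\<in>U. f i) + conn_cost n w U"
  by (simp add: fl_cost_def conn_cost_def set_dist_def)

lemma edge_in_edges:
  assumes "a \<in> {1..n}" "b \<in> {1..n}" "a \<noteq> b"
  shows "(min a b, max a b) \<in> edges n"
  using assms by (auto simp: edges_def min_def max_def)

lemma edge_weight_nonneg:
  assumes "\<forall>e\<in>edges n. 0 \<le> w e" "a \<in> {1..n}" "b \<in> {1..n}" "a \<noteq> b"
  shows "0 \<le> edge_weight w a b"
  using assms edge_in_edges[of a n b] by (simp add: edge_weight_def)

lemma path_weight_nonneg:
  assumes "\<forall>e\<in>edges n. 0 \<le> w e" "distinct p" "set p \<subseteq> {1..n}"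
  shows "0 \<le> path_weight w p"
  using assms
  by (induction w p rule: path_weight.induct) (auto intro!: add_nonneg_nonneg edge_weight_nonneg)

lemma path_weight_suffix_le:
  assumes "\<forall>e\<in>edges n. 0 \<le> w e" "distinct (p @ x # q)" "set (p @ x # q) \<subseteq> {1..n}"
  shows "path_weight w (x # q) \<le> path_weight w (p @ x # q)"
  using assms(2,3)
proof (induction p)
  case (Cons a p)
  have IH: "path_weight w (x # q) \<le> path_weight w (p @ x # q)"
    using Cons by auto
  obtain b r where br: "p @ x # q = b # r" by (cases p) auto
  have "b \<in> set (p @ x # q)" by (simp only: br) simp
  then have "0 \<le> edge_weight w a b"
    using Cons.prems by (intro edge_weight_nonneg[OF assms(1)]) auto
  then show ?case using IH br by simp
qed simp

lemma path_weight_cong: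
  assumes "\<And>a b. a \<in> set p \<Longrightarrow> b \<in> set p \<Longrightarrow> a \<noteq> b \<Longrightarrow> edge_weight w a b = edge_weight w' a b"
    and "distinct p"
  shows "path_weight w p = path_weight w' p"
  using assms
proof (induction p rule: induct_list012)
  case (3 x y zs)
  have "path_weight w (y # zs) = path_weight w' (y # zs)"
    using 3 by auto
  then show ?case using 3 by simp
qed simp_all

lemma finite_paths: "finite (paths n u v)"
proof (rule finite_subset)
  show "paths n u v \<subseteq> {xs. set xs \<subseteq> {1..n} \<and> distinct xs}"
    by (auto simp: paths_def)
  show "finite {xs. set xs \<subseteq> {1..n} \<and> distinct xs}"
    by (rule finite_subset_distinct) simp
qed

lemma paths_nonempty:
  assumes "u \<in> {1..n}" "v \<in> {1..n}"
  shows "paths n u v \<noteq> {}"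
proof (cases "u = v")
  case True
  then have "[u] \<in> paths n u v" using assms by (simp add: paths_def)
  then show ?thesis by blast
next
  case False
  then have "[u, v] \<in> paths n u v" using assms by (simp add: paths_def)
  then show ?thesis by blast
qed

lemma set_dist_le:
  assumes "U \<subseteq> {1..n}" "u \<in> U" "p \<in> paths n u v"
  shows "set_dist n w U v \<le> path_weight w p"
proof -
  have "finite U" using assms(1) finite_subset by blast
  then have "set_dist n w U v \<le> dist_sp n w u v"
    using assms by (auto simp: set_dist_def intro!: Min_le)
  also have "\<dots> \<le> path_weight w p"
    using assms finite_paths by (auto simp: dist_sp_def intro!: Min_le)
  finally show ?thesis .
qed

lemma set_dist_attained:
  assumes "U \<subseteq> {1..n}" "U \<noteq> {}" "v \<in> {1..n}"
  obtains u p where "u \<in> U" "p \<in> paths n u v" "set_dist n w U v = path_weight w p"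
proof -
  have "finite U" using assms(1) finite_subset by blast
  then have "set_dist n w U v \<in> (\<lambda>u. dist_sp n w u v) ` U"
    unfolding set_dist_def using assms by (intro Min_in) auto
  then obtain u where u: "u \<in> U" "set_dist n w U v = dist_sp n w u v" by auto
  have "dist_sp n w u v \<in> path_weight w ` paths n u v"
    unfolding dist_sp_def using assms u finite_paths paths_nonempty[of u n v]
    by (intro Min_in) auto
  then show ?thesis using u that by auto
qed

text \<open>Cut a shortest path at its last vertex in \<open>U\<close>: with nonnegative weights the
  remaining suffix is no heavier, and it uses a single edge of the cut at most.\<close>

lemma set_dist_exit_path:
  assumes w: "\<forall>e\<in>edges n. 0 \<le> w e" and U: "U \<subseteq> {1..n}" "U \<noteq> {}" "v \<in> {1..n}"
  obtains u q where "u \<in> U" "u # q \<in> paths n u v" "set q \<inter> U = {}"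
    "path_weight w (u # q) \<le> set_dist n w U v"
proof -
  obtain u0 p where p: "u0 \<in> U" "p \<in> paths n u0 v" "set_dist n w U v = path_weight w p"
    using set_dist_attained[OF U] .
  have "\<exists>x\<in>set p. x \<in> U" using p by (intro bexI[of _ u0]) (auto simp: paths_def)
  then obtain ys u q where q: "p = ys @ u # q" "u \<in> U" "\<forall>z\<in>set q. z \<notin> U"
    by (rule split_list_last_propE)
  have "path_weight w (u # q) \<le> path_weight w p"
    using p q unfolding q(1) by (intro path_weight_suffix_le[OF w]) (auto simp: paths_def)
  moreover have "u # q \<in> paths n u v" using p q by (auto simp: paths_def)
  ultimately show ?thesis using that[of u q] q p(3) by auto
qed

lemma set_dist_nonneg:
  assumes "\<forall>e\<in>edges n. 0 \<le> w e" "U \<subseteq> {1..n}" "U \<noteq> {}" "v \<in> {1..n}"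
  shows "0 \<le> set_dist n w U v"
proof -
  obtain u p where p: "u \<in> U" "p \<in> paths n u v" "set_dist n w U v = path_weight w p"
    using set_dist_attained[OF assms(2-4)] .
  then show ?thesis using path_weight_nonneg[OF assms(1), of p] by (auto simp: paths_def)
qed

lemma set_dist_self:
  assumes "\<forall>e\<in>edges n. 0 \<le> w e" "U \<subseteq> {1..n}" "v \<in> U"
  shows "set_dist n w U v = 0"
proof (rule antisym)
  have "[v] \<in> paths n v v" using assms by (auto simp: paths_def)
  from set_dist_le[OF assms(2,3) this] show "set_dist n w U v \<le> 0" by simp
  show "0 \<le> set_dist n w U v" using assms by (intro set_dist_nonneg) auto
qed

lemma conn_cost_nonneg:
  assumes "\<forall>e\<in>edges n. 0 \<le> w e" "U \<subseteq> {1..n}" "U \<noteq> {}"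
  shows "0 \<le> conn_cost n w U"
  unfolding conn_cost_def using set_dist_nonneg[OF assms] by (auto intro!: sum_nonneg)

text \<open>Vertices of \<open>U\<close> are at distance 0. Any part \<open>W\<close> of
  \<open>U\<close> may be dropped, so that the costs of \<open>U\<close> and of
  \<open>insert v U\<close> can be compared over the same index set
  \<open>{1..n} - U\<close>.\<close>

lemma conn_cost_outside:
  assumes "\<forall>e\<in>edges n. 0 \<le> w e" "U \<subseteq> {1..n}" "W \<subseteq> U"
  shows "conn_cost n w U = (\<Sum>v\<in>{1..n} - W. set_dist n w U v)"
  unfolding conn_cost_def using assms set_dist_self[OF assms(1,2)]
  by (intro sum.mono_neutral_right) auto

text \<open>One step of the growth of the ball around \<open>U\<close>: the cheapest edge of the cut, joining \<open>u\<close>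
  to \<open>v\<close>, has weight \<open>y\<close>; the residual weights \<open>w2\<close> are \<open>w1 - y\<close> on the rest of the cut. The
  weight of the edge itself is irrelevant in \<open>w2\<close>, as it is now internal to the ball.\<close>

lemma set_dist_grow:
  assumes w1: "\<forall>e\<in>edges n. 0 \<le> w1 e" and w2: "\<forall>e\<in>edges n. 0 \<le> w2 e"
    and U: "U \<subseteq> {1..n}" "u \<in> U" and v: "v \<in> {1..n} - U"
    and uv: "edge_weight w1 u v = y"
    and cut: "\<And>a b. a \<in> U \<Longrightarrow> b \<in> {1..n} - U \<Longrightarrow> (a, b) \<noteq> (u, v) \<Longrightarrow>
                edge_weight w1 a b = y + edge_weight w2 a b"
    and out: "\<And>a b. a \<in> {1..n} - U \<Longrightarrow> b \<in> {1..n} - U \<Longrightarrow> a \<noteq> b \<Longrightarrow>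
                edge_weight w1 a b = edge_weight w2 a b"
    and x: "x \<in> {1..n} - U"
  shows "set_dist n w1 U x = y + set_dist n w2 (insert v U) x"
proof -
  have pw_out: "path_weight w1 q = path_weight w2 q"
    if "set q \<subseteq> {1..n}" "set q \<inter> U = {}" "distinct q" for q
    using that by (intro path_weight_cong out) auto
  have U': "insert v U \<subseteq> {1..n}" using U v by auto
  show ?thesis
  proof (rule antisym)
    have "U \<noteq> {}" "x \<in> {1..n}" using U x by auto
    obtain a q where q: "a \<in> U" "a # q \<in> paths n a x" "set q \<inter> U = {}"
      "path_weight w1 (a # q) \<le> set_dist n w1 U x"
      using set_dist_exit_path[OF w1 U(1) \<open>U \<noteq> {}\<close> \<open>x \<in> {1..n}\<close>] .
    have "q \<noteq> []" using q x by (auto simp: paths_def)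
    then obtain b r where r: "q = b # r" by (cases q) auto
    have eq: "path_weight w1 q = path_weight w2 q"
      using q by (intro pw_out) (auto simp: paths_def)
    \<comment> \<open>The path leaves \<open>U\<close> along its first edge. If that edge joins
      \<open>u\<close> to \<open>v\<close>, the rest already starts in the enlarged ball; otherwise
      the first edge alone accounts for the difference \<open>y\<close>.\<close>
    have "y + set_dist n w2 (insert v U) x \<le> path_weight w1 (a # q)"
    proof (cases "(a, b) = (u, v)")
      case True
      have "q \<in> paths n v x" using q r True by (auto simp: paths_def)
      then have "set_dist n w2 (insert v U) x \<le> path_weight w2 q"
        by (intro set_dist_le[OF U']) auto
      then show ?thesis using True r eq uv by simp
    next
      case False
      have "set_dist n w2 (insert v U) x \<le> path_weight w2 (a # q)"
        using q by (intro set_dist_le[OF U']) auto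
      moreover have "edge_weight w1 a b = y + edge_weight w2 a b"
        using q r False by (intro cut) (auto simp: paths_def)
      ultimately show ?thesis using r eq by simp
    qed
    then show "y + set_dist n w2 (insert v U) x \<le> set_dist n w1 U x" using q by simp
  next
    have "x \<in> {1..n}" using x by auto
    obtain a q where q: "a \<in> insert v U" "a # q \<in> paths n a x" "set q \<inter> insert v U = {}"
      "path_weight w2 (a # q) \<le> set_dist n w2 (insert v U) x"
      using set_dist_exit_path[OF w2 U' _ \<open>x \<in> {1..n}\<close>] by blast
    \<comment> \<open>Conversely, a path starting at the new vertex \<open>v\<close> is extended
      backwards by the edge from \<open>u\<close>, at cost \<open>y\<close>.\<close>
    have "set_dist n w1 U x \<le> y + path_weight w2 (a # q)"
    proof (cases "a \<in> U")
      case True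
      have "q \<noteq> []" using q x True by (auto simp: paths_def)
      then obtain b r where r: "q = b # r" by (cases q) auto
      have "path_weight w1 q = path_weight w2 q"
        using q by (intro pw_out) (auto simp: paths_def)
      moreover have "edge_weight w1 a b = y + edge_weight w2 a b"
        using q r True by (intro cut) (auto simp: paths_def)
      ultimately have "path_weight w1 (a # q) = y + path_weight w2 (a # q)" using r by simp
      then show ?thesis using set_dist_le[OF U(1) True q(2), of w1] by simp
    next
      case False
      then have [simp]: "a = v" using q by auto
      have "path_weight w1 (v # q) = path_weight w2 (v # q)"
        using q v by (intro pw_out) (auto simp: paths_def)
      moreover have "u # v # q \<in> paths n u x" using q U v by (auto simp: paths_def)
      ultimately show ?thesis using set_dist_le[OF U(1,2), of "u # v # q" x w1] uv by simp
    qed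
    then show "set_dist n w1 U x \<le> y + set_dist n w2 (insert v U) x" using q by simp
  qed
qed

text \<open>All \<open>n - card U\<close> vertices outside \<open>U\<close>, the new vertex
  \<open>v\<close> included, are \<open>y\<close> farther away, and the vertices of \<open>U\<close>
  contribute nothing.\<close>

lemma conn_cost_grow:
  assumes w1: "\<forall>e\<in>edges n. 0 \<le> w1 e" and w2: "\<forall>e\<in>edges n. 0 \<le> w2 e"
    and U: "U \<subseteq> {1..n}" "u \<in> U" and v: "v \<in> {1..n} - U"
    and uv: "edge_weight w1 u v = y"
    and cut: "\<And>a b. a \<in> U \<Longrightarrow> b \<in> {1..n} - U \<Longrightarrow> (a, b) \<noteq> (u, v) \<Longrightarrow>
                edge_weight w1 a b = y + edge_weight w2 a b"
    and out: "\<And>a b. a \<in> {1..n} - U \<Longrightarrow> b \<in> {1..n} - U \<Longrightarrow> a \<noteq> b \<Longrightarrow>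
                edge_weight w1 a b = edge_weight w2 a b"
  shows "conn_cost n w1 U = (real n - real (card U)) * y + conn_cost n w2 (insert v U)"
proof -
  have fin: "finite U" using U finite_subset by blast
  have le: "card U \<le> n" using card_mono[OF _ U(1)] by simp
  have "conn_cost n w1 U = (\<Sum>x\<in>{1..n} - U. set_dist n w1 U x)"
    using conn_cost_outside[OF w1 U(1)] by simp
  also have "\<dots> = (\<Sum>x\<in>{1..n} - U. y + set_dist n w2 (insert v U) x)"
    using set_dist_grow[OF w1 w2 U v uv cut out] by (intro sum.cong) auto
  also have "\<dots> = real (n - card U) * y + (\<Sum>x\<in>{1..n} - U. set_dist n w2 (insert v U) x)"
    using fin U by (simp add: sum.distrib card_Diff_subset)
  also have "(\<Sum>x\<in>{1..n} - U. set_dist n w2 (insert v U) x) = conn_cost n w2 (insert v U)"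
    using v U by (intro conn_cost_outside[OF w2, symmetric]) auto
  finally show ?thesis using le by (simp add: of_nat_diff)
qed

section \<open>Exponential moments of the connection cost\<close>

abbreviation exp1 :: "real measure" where
  "exp1 \<equiv> density lborel (exponential_density 1)"

lemma prob_space_exp1: "prob_space exp1"
  by (rule prob_space_exponential_density) simp

lemma AE_exp1_nonneg: "AE x in exp1. 0 \<le> x"
  by (subst AE_density) (auto simp: exponential_density_def)

text \<open>Substituting \<open>y + z\<close> for \<open>z\<close> splits the density into
  \<open>exp (- y)\<close> and the density at \<open>z\<close>.\<close>

lemma nn_integral_exp1_memoryless:
  assumes [measurable]: "h \<in> borel_measurable borel" and y: "0 \<le> y"
  shows "(\<integral>\<^sup>+z. (if y \<le> z then h (z - y) else 0) \<partial>exp1) = ennreal (exp (- y)) * (\<integral>\<^sup>+z. h z \<partial>exp1)"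
proof -
  have "(\<integral>\<^sup>+z. (if y \<le> z then h (z - y) else 0) \<partial>exp1)
      = (\<integral>\<^sup>+z. ennreal (exponential_density 1 z) * (if y \<le> z then h (z - y) else 0) \<partial>lborel)"
    by (subst nn_integral_density) auto
  also have "\<dots> = (\<integral>\<^sup>+z. ennreal (exponential_density 1 (y + z)) * (if 0 \<le> z then h z else 0) \<partial>lborel)"
    by (subst nn_integral_real_affine[where c = 1 and t = y]) (auto intro!: nn_integral_cong)
  also have "\<dots> = (\<integral>\<^sup>+z. ennreal (exp (- y)) * (ennreal (exponential_density 1 z) * h z) \<partial>lborel)"
    using y by (intro nn_integral_cong)
      (auto simp: exponential_density_def mult.assoc[symmetric] ennreal_mult[symmetric] exp_add[symmetric])
  also have "\<dots> = ennreal (exp (- y)) * (\<integral>\<^sup>+z. h z \<partial>exp1)"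
    by (subst nn_integral_cmult) (auto simp: nn_integral_density)
  finally show ?thesis .
qed

text \<open>Tilting the density by \<open>exp (- s * y)\<close> gives \<open>1 / (1 + s)\<close>
  times the exponential density of rate \<open>1 + s\<close>. Negative \<open>s\<close> above
  \<open>-1\<close> is allowed, so that positive exponential moments are covered as well.\<close>

lemma nn_integral_exp1_exp:
  assumes "0 < 1 + s"
  shows "(\<integral>\<^sup>+y. ennreal (exp (- s * y)) \<partial>exp1) = ennreal (1 / (1 + s))"
proof -
  interpret P: prob_space "density lborel (exponential_density (1 + s))"
    using assms by (rule prob_space_exponential_density)
  have one: "(\<integral>\<^sup>+y. ennreal (exponential_density (1 + s) y) \<partial>lborel) = 1"
    using P.emeasure_space_1 by (subst (asm) emeasure_density) (auto simp: space_density)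
  have "(\<integral>\<^sup>+y. ennreal (exp (- s * y)) \<partial>exp1)
      = (\<integral>\<^sup>+y. ennreal (exponential_density 1 y) * ennreal (exp (- s * y)) \<partial>lborel)"
    by (subst nn_integral_density) auto
  also have "\<dots> = (\<integral>\<^sup>+y. ennreal (1 / (1 + s)) * ennreal (exponential_density (1 + s) y) \<partial>lborel)"
  proof (intro nn_integral_cong)
    fix y :: real
    have "exponential_density 1 y * exp (- s * y) = 1 / (1 + s) * exponential_density (1 + s) y"
    proof -
      have "exp (- y) * exp (- s * y) = exp (- y * (1 + s))"
        by (simp add: exp_add[symmetric] algebra_simps)
      then show ?thesis using assms by (auto simp: exponential_density_def)
    qed
    then show "ennreal (exponential_density 1 y) * ennreal (exp (- s * y)) =
        ennreal (1 / (1 + s)) * ennreal (exponential_density (1 + s) y)"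
      using assms by (simp add: ennreal_mult[symmetric] exponential_density_nonneg)
  qed
  also have "\<dots> = ennreal (1 / (1 + s))"
    by (subst nn_integral_cmult) (auto simp: one)
  finally show ?thesis .
qed

interpretation exp1: product_prob_space "\<lambda>_::nat \<times> nat. exp1" UNIV
  by (intro product_prob_space.intro product_sigma_finite.intro product_prob_space_axioms.intro
      prob_space_exp1 prob_space_imp_sigma_finite)

text \<open>Fubini isolates the coordinate \<open>b\<close>, and memorylessness is applied to the
  inner integral.\<close>

lemma nn_integral_PiM_exp1_shift1:
  fixes J :: "(nat \<times> nat) set"
  assumes J: "finite J" "b \<in> J" and y: "0 \<le> y"
    and h [measurable]: "h \<in> borel_measurable (PiM J (\<lambda>_. exp1))"
  shows "(\<integral>\<^sup>+w. (if y \<le> w b then h (w(b := w b - y)) else 0) \<partial>PiM J (\<lambda>_. exp1))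
    = ennreal (exp (- y)) * (\<integral>\<^sup>+w. h w \<partial>PiM J (\<lambda>_. exp1))"
proof -
  have JI: "insert b J = J" using J by auto
  have h' [measurable]: "h \<in> borel_measurable (PiM (insert b (J - {b})) (\<lambda>_. exp1))"
    by (simp add: JI)
  have m1: "(\<lambda>w. w(b := w b - y)) \<in> measurable (PiM J (\<lambda>_. exp1)) (PiM J (\<lambda>_. exp1))"
    using J by (intro measurable_fun_upd[where J = J]) auto
  have m2: "(\<lambda>w. w b) \<in> borel_measurable (PiM J (\<lambda>_. exp1))"
    using measurable_component_singleton[OF J(2), of "\<lambda>_. exp1"] by simp
  have "(\<lambda>w. if y \<le> w b then h (w(b := w b - y)) else 0) \<in> borel_measurable (PiM J (\<lambda>_. exp1))"
    using measurable_compose[OF m1 h] m2 by measurable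
  then have "(\<lambda>w. if y \<le> w b then h (w(b := w b - y)) else 0) \<in>
      borel_measurable (PiM (insert b (J - {b})) (\<lambda>_. exp1))"
    by (simp add: JI)
  note eq = exp1.product_nn_integral_insert[OF _ _ this]
  have "(\<integral>\<^sup>+w. (if y \<le> w b then h (w(b := w b - y)) else 0) \<partial>PiM J (\<lambda>_. exp1)) =
    (\<integral>\<^sup>+x. \<integral>\<^sup>+z. (if y \<le> z then h (x(b := z - y)) else 0) \<partial>exp1 \<partial>PiM (J - {b}) (\<lambda>_. exp1))"
    using eq J by (simp add: JI cong: if_cong)
  also have "\<dots> = (\<integral>\<^sup>+x. ennreal (exp (- y)) * (\<integral>\<^sup>+z. h (x(b := z)) \<partial>exp1) \<partial>PiM (J - {b}) (\<lambda>_. exp1))"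
  proof (intro nn_integral_cong nn_integral_exp1_memoryless y)
    fix x assume x: "x \<in> space (PiM (J - {b}) (\<lambda>_. exp1))"
    have "(\<lambda>z. x(b := z)) \<in> measurable exp1 (PiM (insert b (J - {b})) (\<lambda>_. exp1))"
      using x by (intro measurable_fun_upd[where J = "J - {b}"]) auto
    from measurable_compose[OF this h'] show "(\<lambda>z. h (x(b := z))) \<in> borel_measurable borel"
      by simp
  qed
  also have "\<dots> = ennreal (exp (- y)) * (\<integral>\<^sup>+x. \<integral>\<^sup>+z. h (x(b := z)) \<partial>exp1 \<partial>PiM (J - {b}) (\<lambda>_. exp1))"
  proof (rule nn_integral_cmult)
    interpret sigma_finite_measure exp1 by (rule exp1.sigma_finite_measures)
    show "(\<lambda>x. \<integral>\<^sup>+z. h (x(b := z)) \<partial>exp1) \<in> borel_measurable (PiM (J - {b}) (\<lambda>_. exp1))"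
      by measurable
  qed
  also have "\<dots> = ennreal (exp (- y)) * (\<integral>\<^sup>+w. h w \<partial>PiM J (\<lambda>_. exp1))"
    using exp1.product_nn_integral_insert[OF _ _ h'] J by (simp add: JI)
  finally show ?thesis .
qed

text \<open>The residual weights once every edge of \<open>B\<close> is known to weigh at least
  \<open>y\<close>.\<close>

definition shift_weights :: "'i set \<Rightarrow> real \<Rightarrow> ('i \<Rightarrow> real) \<Rightarrow> 'i \<Rightarrow> real" where
  "shift_weights B y w = (\<lambda>j. if j \<in> B then w j - y else w j)"

text \<open>Joint memorylessness, one coordinate at a time. The integrand is generalized in the
  induction because the condition and the shift at the new coordinate are absorbed into it.\<close>

lemma nn_integral_PiM_exp1_shift:
  fixes J :: "(nat \<times> nat) set"
  assumes "finite B" "finite J" "B \<subseteq> J" "0 \<le> y" "h \<in> borel_measurable (PiM J (\<lambda>_. exp1))"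
  shows "(\<integral>\<^sup>+w. (if \<forall>j\<in>B. y \<le> w j then h (shift_weights B y w) else 0) \<partial>PiM J (\<lambda>_. exp1))
    = ennreal (exp (- (real (card B) * y))) * (\<integral>\<^sup>+w. h w \<partial>PiM J (\<lambda>_. exp1))"
  using assms
proof (induction B arbitrary: h rule: finite_induct)
  case empty
  then show ?case by (simp add: shift_weights_def)
next
  case (insert b B)
  define g where "g w = (if y \<le> w b then h (w(b := w b - y)) else 0)" for w
  have b: "b \<in> J" using insert by auto
  have m1: "(\<lambda>w. w(b := w b - y)) \<in> measurable (PiM J (\<lambda>_. exp1)) (PiM J (\<lambda>_. exp1))"
    using b by (intro measurable_fun_upd[where J = J]) auto
  have m2: "(\<lambda>w. w b) \<in> borel_measurable (PiM J (\<lambda>_. exp1))"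
    using measurable_component_singleton[OF b, of "\<lambda>_. exp1"] by simp
  have g: "g \<in> borel_measurable (PiM J (\<lambda>_. exp1))"
    unfolding g_def using measurable_compose[OF m1 insert.prems(4)] m2 by measurable
  have sh: "(shift_weights B y w)(b := w b - y) = shift_weights (insert b B) y w" "shift_weights B y w b = w b" for w
    using insert.hyps by (auto simp: shift_weights_def fun_eq_iff)
  have "(\<integral>\<^sup>+w. (if \<forall>j\<in>insert b B. y \<le> w j then h (shift_weights (insert b B) y w) else 0) \<partial>PiM J (\<lambda>_. exp1))
      = (\<integral>\<^sup>+w. (if \<forall>j\<in>B. y \<le> w j then g (shift_weights B y w) else 0) \<partial>PiM J (\<lambda>_. exp1))"
    by (intro nn_integral_cong) (auto simp: g_def sh)
  also have "\<dots> = ennreal (exp (- (real (card B) * y))) * (\<integral>\<^sup>+w. g w \<partial>PiM J (\<lambda>_. exp1))"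
    using insert.prems g by (intro insert.IH) auto
  also have "(\<integral>\<^sup>+w. g w \<partial>PiM J (\<lambda>_. exp1)) = ennreal (exp (- y)) * (\<integral>\<^sup>+w. h w \<partial>PiM J (\<lambda>_. exp1))"
    unfolding g_def using insert.prems b by (intro nn_integral_PiM_exp1_shift1) auto
  finally show ?case using insert.hyps
    by (simp add: mult.assoc[symmetric] ennreal_mult[symmetric] exp_add[symmetric] algebra_simps)
qed

text \<open>The coordinate \<open>e\<close> is replaced by an independent copy \<open>y\<close>. Its
  old value is overwritten but stays in the product, so the inner integral is again over the full
  index set \<open>J\<close> rather than over \<open>J - {e}\<close>; this lets the recursion below
  stay in one space.\<close>

lemma nn_integral_PiM_exp1_resample:
  fixes J :: "(nat \<times> nat) set"
  assumes J: "finite J" "e \<in> J" and F: "F \<in> borel_measurable (PiM J (\<lambda>_. exp1))"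
  shows "(\<integral>\<^sup>+w. F w \<partial>PiM J (\<lambda>_. exp1)) = (\<integral>\<^sup>+y. \<integral>\<^sup>+w. F (w(e := y)) \<partial>PiM J (\<lambda>_. exp1) \<partial>exp1)"
proof -
  have JI: "insert e J = J" using J by auto
  have F': "F \<in> borel_measurable (PiM (insert e (J - {e})) (\<lambda>_. exp1))"
    using F by (simp add: JI)
  have "(\<integral>\<^sup>+w. F w \<partial>PiM J (\<lambda>_. exp1)) = (\<integral>\<^sup>+y. \<integral>\<^sup>+x. F (x(e := y)) \<partial>PiM (J - {e}) (\<lambda>_. exp1) \<partial>exp1)"
    using exp1.product_nn_integral_insert_rev[OF _ _ F'] J by (simp add: JI)
  also have "\<dots> = (\<integral>\<^sup>+y. \<integral>\<^sup>+w. F (w(e := y)) \<partial>PiM J (\<lambda>_. exp1) \<partial>exp1)"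
  proof (rule nn_integral_cong)
    fix y :: real
    have "(\<lambda>w. w(e := y)) \<in> measurable (PiM J (\<lambda>_. exp1)) (PiM J (\<lambda>_. exp1))"
      using J by (intro measurable_fun_upd[where J = J]) auto
    from measurable_compose[OF this F] 
    have "(\<lambda>w. F (w(e := y))) \<in> borel_measurable (PiM (insert e (J - {e})) (\<lambda>_. exp1))"
      by (simp add: JI)
    from exp1.product_nn_integral_insert[OF _ _ this]
    have "(\<integral>\<^sup>+w. F (w(e := y)) \<partial>PiM J (\<lambda>_. exp1)) =
        (\<integral>\<^sup>+x. \<integral>\<^sup>+z. F (x(e := y)) \<partial>exp1 \<partial>PiM (J - {e}) (\<lambda>_. exp1))"
      using J by (simp add: JI)
    then show "(\<integral>\<^sup>+x. F (x(e := y)) \<partial>PiM (J - {e}) (\<lambda>_. exp1)) =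
        (\<integral>\<^sup>+w. F (w(e := y)) \<partial>PiM J (\<lambda>_. exp1))"
      using prob_space.emeasure_space_1[OF prob_space_exp1] by simp
  qed
  finally show ?thesis .
qed

section \<open>The space of edge weights and measurability of the costs\<close>

lemma prob_space_weight_space: "prob_space (weight_space n)"
  unfolding weight_space_def by (intro prob_space_PiM prob_space_exp1)

lemma finite_edges: "finite (edges n)"
  by (rule finite_subset[of _ "{1..n} \<times> {1..n}"]) (auto simp: edges_def)

lemma AE_weights_nonneg: "AE w in weight_space n. \<forall>e\<in>edges n. 0 \<le> w e"
  unfolding weight_space_def
  by (intro AE_finite_allI finite_edges AE_PiM_component prob_space_exp1 AE_exp1_nonneg)

lemma measurable_edge_weight:
  assumes "a \<in> {1..n}" "b \<in> {1..n}" "a \<noteq> b"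
  shows "(\<lambda>w. edge_weight w a b) \<in> borel_measurable (weight_space n)"
  using measurable_component_singleton[OF edge_in_edges[OF assms], of "\<lambda>_. exp1"]
  by (simp add: edge_weight_def weight_space_def)

lemma measurable_path_weight:
  assumes "distinct p" "set p \<subseteq> {1..n}"
  shows "(\<lambda>w. path_weight w p) \<in> borel_measurable (weight_space n)"
  using assms
proof (induction p rule: induct_list012)
  case (3 x y zs)
  then show ?case by (auto intro!: borel_measurable_add measurable_edge_weight)
qed simp_all

lemma measurable_conn_cost:
  assumes "U \<subseteq> {1..n}"
  shows "(\<lambda>w. conn_cost n w U) \<in> borel_measurable (weight_space n)"
proof -
  have "finite U" using assms finite_subset by blast
  then show ?thesis
    unfolding conn_cost_def set_dist_def dist_sp_def
    using finite_paths
    by (intro borel_measurable_sum borel_measurable_Min measurable_path_weight)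
       (auto simp: paths_def)
qed

lemma pred_cheapest_edge:
  assumes "e \<in> edges n" "B \<subseteq> edges n"
  shows "Measurable.pred (weight_space n) (\<lambda>w. \<forall>j\<in>B. w e \<le> w j)"
proof (rule pred_intros_finite(3))
  show "finite B" using assms(2) finite_edges finite_subset by blast
  have comp: "(\<lambda>w. w j) \<in> borel_measurable (weight_space n)" if "j \<in> edges n" for j
    using measurable_component_singleton[OF that, of "\<lambda>_. exp1"] by (simp add: weight_space_def)
  fix j assume "j \<in> B"
  then have [measurable]: "(\<lambda>w. w j) \<in> borel_measurable (weight_space n)"
    "(\<lambda>w. w e) \<in> borel_measurable (weight_space n)" using assms by (blast intro: comp)+
  show "Measurable.pred (weight_space n) (\<lambda>w. w e \<le> w j)"
    unfolding pred_def by (rule borel_measurable_le) measurable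
qed

section \<open>Cuts and the recursion for exponential moments\<close>

definition cut_edges :: "nat \<Rightarrow> nat set \<Rightarrow> (nat \<times> nat) set" where
  "cut_edges n U = (\<lambda>(a, b). (min a b, max a b)) ` (U \<times> ({1..n} - U))"

text \<open>Exactly one endpoint of a cut edge lies in \<open>U\<close>, so the unordered edge
  determines its orientation.\<close>

lemma inj_on_edge_of_cut:
  "inj_on (\<lambda>(a::nat, b). (min a b, max a b)) (U \<times> ({1..n} - U))"
proof (rule inj_onI, clarify)
  fix a b c d
  assume *: "a \<in> U" "b \<notin> U" "c \<in> U" "d \<notin> U" "min a b = min c d" "max a b = max c d"
  then have "(a = c \<and> b = d) \<or> (a = d \<and> b = c)"
    by (auto simp: min_def max_def split: if_splits)
  then show "a = c \<and> b = d" using * by auto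
qed

lemma cut_edges_subset: "U \<subseteq> {1..n} \<Longrightarrow> cut_edges n U \<subseteq> edges n"
  unfolding cut_edges_def using edge_in_edges[of _ n] by fastforce

lemma card_cut_edges:
  assumes "U \<subseteq> {1..n}"
  shows "card (cut_edges n U) = card U * (n - card U)"
  using assms finite_subset[OF assms] unfolding cut_edges_def
  by (subst card_image[OF inj_on_edge_of_cut]) (simp add: card_cartesian_product card_Diff_subset)

text \<open>The contribution of the event that a given edge is the cheapest of the cut: by memorylessness
  the residual weights on the rest of the cut are again independent exponentials.\<close>

lemma exp_moment_cheapest_edge:
  fixes t :: real
  assumes U: "U \<subseteq> {1..n}" "u \<in> U" and v: "v \<in> {1..n} - U" and t: "0 < card U + t"
  defines "e \<equiv> (min u v, max u v)"
  shows "(\<integral>\<^sup>+w. (if \<forall>j\<in>cut_edges n U - {e}. w e \<le> w j then ennreal (exp (- t * conn_cost n w U)) else 0)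
            \<partial>weight_space n)
       = ennreal (1 / ((real n - card U) * (card U + t))) *
         (\<integral>\<^sup>+w. ennreal (exp (- t * conn_cost n w (insert v U))) \<partial>weight_space n)"
proof -
  define B where "B = cut_edges n U - {e}"
  define k where "k = card U"
  define I where "I = (\<integral>\<^sup>+w. ennreal (exp (- t * conn_cost n w (insert v U))) \<partial>weight_space n)"
  have fin: "finite U" using U finite_subset by blast
  have "card U < card {1..n}" using U v by (intro psubset_card_mono) auto
  then have kn: "k < n" by (simp add: k_def)
  have k0: "0 < k" using U fin by (auto simp: k_def card_gt_0_iff)
  have ecut: "e \<in> cut_edges n U" using U v by (auto simp: cut_edges_def e_def)
  have Be: "B \<subseteq> edges n" "e \<in> edges n" using cut_edges_subset[OF U(1)] ecut by (auto simp: B_def)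
  have finB: "finite B" using Be finite_edges finite_subset by blast
  have cardB: "real (card B) = real k * (real n - real k) - 1"
  proof -
    have "0 < k * (n - k)" using k0 kn by simp
    then have "Suc (card B) = k * (n - k)" using ecut card_cut_edges[OF U(1)]
      by (simp add: B_def card_Diff_singleton k_def)
    from arg_cong[OF this, of real] have "1 + real (card B) = real k * real (n - k)" by simp
    then show ?thesis using kn by (simp add: of_nat_diff)
  qed
  have U': "insert v U \<subseteq> {1..n}" using U v by auto
  note mU = measurable_conn_cost[OF U(1)] and mU' = measurable_conn_cost[OF U']
  have "Measurable.pred (weight_space n) (\<lambda>w. \<forall>j\<in>B. w e \<le> w j)"
    by (rule pred_cheapest_edge[OF Be(2,1)])
  then have meas: "(\<lambda>w. if \<forall>j\<in>B. w e \<le> w j then ennreal (exp (- t * conn_cost n w U)) else 0)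
      \<in> borel_measurable (weight_space n)"
    using mU by measurable
  \<comment> \<open>Since \<open>e\<close> is not in \<open>B\<close>, the shifted weights still
    carry the old value \<open>w e\<close>; this is harmless because both endpoints of
    \<open>e\<close> lie in \<open>insert v U\<close>.\<close>
  have grow: "conn_cost n (w(e := y)) U = (real n - k) * y + conn_cost n (shift_weights B y w) (insert v U)"
    if w: "\<forall>j\<in>edges n. 0 \<le> w j" and y: "0 \<le> y" and min: "\<forall>j\<in>B. y \<le> w j" for w y
    unfolding k_def
  proof (rule conn_cost_grow[OF _ _ U v])
    show "\<forall>j\<in>edges n. 0 \<le> (w(e := y)) j" using w y by auto
    show "\<forall>j\<in>edges n. 0 \<le> shift_weights B y w j" using w y min by (auto simp: shift_weights_def)
    show "edge_weight (w(e := y)) u v = y" by (simp add: edge_weight_def e_def)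
    fix a b
    { assume ab: "a \<in> U" "b \<in> {1..n} - U" "(a, b) \<noteq> (u, v)"
      then have "(min a b, max a b) \<noteq> e"
        using inj_onD[OF inj_on_edge_of_cut, of "(a, b)" "(u, v)" U n] U v by (auto simp: e_def)
      moreover have "(min a b, max a b) \<in> cut_edges n U" using ab by (auto simp: cut_edges_def)
      ultimately show "edge_weight (w(e := y)) a b = y + edge_weight (shift_weights B y w) a b"
        by (auto simp: edge_weight_def shift_weights_def B_def) }
    { assume ab: "a \<in> {1..n} - U" "b \<in> {1..n} - U" "a \<noteq> b"
      have "(min a b, max a b) \<notin> cut_edges n U"
        using ab by (auto simp: cut_edges_def min_def max_def split: if_splits)
      then show "edge_weight (w(e := y)) a b = edge_weight (shift_weights B y w) a b"
        using ecut by (auto simp: edge_weight_def shift_weights_def B_def) }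
  qed
  \<comment> \<open>The decay rate in \<open>y\<close>: \<open>card B\<close> for all other cut
    edges to exceed \<open>y\<close>, and \<open>t * (n - k)\<close> from the growth of the cost.
    The density of \<open>y\<close> adds 1, and the total factors as
    \<open>(n - k) * (k + t)\<close>.\<close>
  define s where "s = real (card B) + t * (real n - k)"
  have s1: "1 + s = (real n - k) * (k + t)" using cardB by (simp add: s_def algebra_simps)
  have s0: "0 < 1 + s" unfolding s1 using kn t by (intro mult_pos_pos) (auto simp: k_def)
  have "(\<integral>\<^sup>+w. (if \<forall>j\<in>B. w e \<le> w j then ennreal (exp (- t * conn_cost n w U)) else 0) \<partial>weight_space n)
    = (\<integral>\<^sup>+y. \<integral>\<^sup>+w. (if \<forall>j\<in>B. (w(e := y)) e \<le> (w(e := y)) j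
          then ennreal (exp (- t * conn_cost n (w(e := y)) U)) else 0) \<partial>weight_space n \<partial>exp1)"
    unfolding weight_space_def
    by (rule nn_integral_PiM_exp1_resample[OF finite_edges Be(2) meas[unfolded weight_space_def]])
  also have "\<dots> = (\<integral>\<^sup>+y. ennreal (exp (- s * y)) * I \<partial>exp1)"
  proof (rule nn_integral_cong_AE, use AE_exp1_nonneg in eventually_elim)
    fix y :: real assume y: "0 \<le> y"
    define h where "h w = ennreal (exp (- t * ((real n - k) * y))) *
        ennreal (exp (- t * conn_cost n w (insert v U)))" for w
    have h: "h \<in> borel_measurable (weight_space n)" unfolding h_def using mU' by measurable
    have "(\<integral>\<^sup>+w. (if \<forall>j\<in>B. (w(e := y)) e \<le> (w(e := y)) j
          then ennreal (exp (- t * conn_cost n (w(e := y)) U)) else 0) \<partial>weight_space n)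
        = (\<integral>\<^sup>+w. (if \<forall>j\<in>B. y \<le> w j then h (shift_weights B y w) else 0) \<partial>weight_space n)"
    proof (rule nn_integral_cong_AE, use AE_weights_nonneg in eventually_elim)
      fix w :: "nat \<times> nat \<Rightarrow> real" assume w: "\<forall>j\<in>edges n. 0 \<le> w j"
      have "(\<forall>j\<in>B. (w(e := y)) e \<le> (w(e := y)) j) \<longleftrightarrow> (\<forall>j\<in>B. y \<le> w j)"
        by (auto simp: B_def)
      moreover have "ennreal (exp (- t * conn_cost n (w(e := y)) U)) = h (shift_weights B y w)"
        if "\<forall>j\<in>B. y \<le> w j"
        by (simp add: grow[OF w y that] h_def ennreal_mult[symmetric] exp_add[symmetric] algebra_simps)
      ultimately show "(if \<forall>j\<in>B. (w(e := y)) e \<le> (w(e := y)) j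
          then ennreal (exp (- t * conn_cost n (w(e := y)) U)) else 0)
          = (if \<forall>j\<in>B. y \<le> w j then h (shift_weights B y w) else 0)"
        by simp
    qed
    also have "\<dots> = ennreal (exp (- (real (card B) * y))) * (\<integral>\<^sup>+w. h w \<partial>weight_space n)"
      using h unfolding weight_space_def
      by (intro nn_integral_PiM_exp1_shift finB finite_edges Be y)
    also have "(\<integral>\<^sup>+w. h w \<partial>weight_space n) = ennreal (exp (- t * ((real n - k) * y))) * I"
      unfolding h_def I_def using mU' by (intro nn_integral_cmult) measurable
    also have "ennreal (exp (- (real (card B) * y))) * (ennreal (exp (- t * ((real n - k) * y))) * I)
        = ennreal (exp (- (real (card B) * y)) * exp (- t * ((real n - k) * y))) * I"
      by (simp add: ennreal_mult mult.assoc)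
    also have "exp (- (real (card B) * y)) * exp (- t * ((real n - k) * y)) = exp (- s * y)"
      by (simp add: exp_add[symmetric] s_def algebra_simps)
    finally show "(\<integral>\<^sup>+w. (if \<forall>j\<in>B. (w(e := y)) e \<le> (w(e := y)) j
          then ennreal (exp (- t * conn_cost n (w(e := y)) U)) else 0) \<partial>weight_space n)
        = ennreal (exp (- s * y)) * I" .
  qed
  also have "\<dots> = (\<integral>\<^sup>+y. ennreal (exp (- s * y)) \<partial>exp1) * I"
    by (intro nn_integral_multc) measurable
  also have "\<dots> = ennreal (1 / (1 + s)) * I"
    by (subst nn_integral_exp1_exp[OF s0]) simp
  finally show ?thesis by (simp add: s1 I_def B_def k_def)
qed

text \<open>Induction on the number of vertices still to be reached. Each of the
  \<open>k * (n - k)\<close> cut edges, when cheapest, contributes at most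
  \<open>1 / ((n - k) * (k + t))\<close> times the bound for \<open>k + 1\<close> facilities; summed
  up, this is the factor \<open>k / (k + t)\<close>.\<close>

lemma exp_moment_conn_cost:
  fixes t :: real
  assumes "U \<subseteq> {1..n}" "U \<noteq> {}" "0 < card U + t"
  shows "(\<integral>\<^sup>+w. ennreal (exp (- t * conn_cost n w U)) \<partial>weight_space n)
    \<le> ennreal (\<Prod>i\<in>{card U..<n}. real i / (real i + t))"
  using assms
proof (induction "n - card U" arbitrary: U)
  case 0
  have "card {1..n} \<le> card U" using 0 by simp
  then have U: "U = {1..n}" using card_seteq[OF _ 0(2)] by simp
  have "(\<integral>\<^sup>+w. ennreal (exp (- t * conn_cost n w U)) \<partial>weight_space n) = (\<integral>\<^sup>+w. 1 \<partial>weight_space n)"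
  proof (rule nn_integral_cong_AE, use AE_weights_nonneg in eventually_elim)
    fix w :: "nat \<times> nat \<Rightarrow> real" assume "\<forall>e\<in>edges n. 0 \<le> w e"
    from conn_cost_outside[OF this, of U U] have "conn_cost n w U = 0" using U by simp
    then show "ennreal (exp (- t * conn_cost n w U)) = 1" by simp
  qed
  then show ?case using U prob_space.emeasure_space_1[OF prob_space_weight_space] by simp
next
  case (Suc m)
  define k where "k = card U"
  define P where "P = U \<times> ({1..n} - U)"
  define ed where "ed = (\<lambda>p. (min (fst p) (snd p), max (fst p) (snd p) :: nat))"
  define G where "G p w = (if \<forall>j\<in>cut_edges n U - {ed p}. w (ed p) \<le> w j
      then ennreal (exp (- t * conn_cost n w U)) else 0)" for p w
  define Q where "Q = (\<Prod>i\<in>{Suc k..<n}. real i / (real i + t))"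
  define r where "r = 1 / ((real n - k) * (k + t))"
  have fin: "finite U" using Suc.prems finite_subset by blast
  have kn: "k < n" using Suc.hyps(2) by (simp add: k_def)
  have k0: "0 < k" using Suc.prems fin by (auto simp: k_def card_gt_0_iff)
  have r0: "0 \<le> r" using kn Suc.prems(3) by (auto simp: r_def k_def intro!: divide_nonneg_nonneg mult_nonneg_nonneg)
  have Q0: "0 \<le> Q" unfolding Q_def using Suc.prems(3)
    by (intro prod_nonneg divide_nonneg_nonneg) (auto simp: k_def)
  have finP: "finite P" using fin by (simp add: P_def)
  have cardP: "card P = k * (n - k)"
    using fin Suc.prems by (simp add: P_def k_def card_cartesian_product card_Diff_subset)
  have cut: "cut_edges n U = ed ` P" unfolding cut_edges_def ed_def P_def by (intro image_cong) auto
  have "P \<noteq> {}" using cardP k0 kn by auto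
  have mG: "G p \<in> borel_measurable (weight_space n)" if p: "p \<in> P" for p
  proof -
    have "Measurable.pred (weight_space n) (\<lambda>w. \<forall>j\<in>cut_edges n U - {ed p}. w (ed p) \<le> w j)"
      using p cut cut_edges_subset[OF Suc.prems(1)] by (intro pred_cheapest_edge) auto
    then show ?thesis unfolding G_def using measurable_conn_cost[OF Suc.prems(1)] by measurable
  qed
  have one: "(\<integral>\<^sup>+w. G p w \<partial>weight_space n) \<le> ennreal (r * Q)" if p: "p \<in> P" for p
  proof -
    obtain u v where uv: "p = (u, v)" "u \<in> U" "v \<in> {1..n} - U" using p by (auto simp: P_def)
    have c: "card (insert v U) = Suc k" using uv fin by (simp add: k_def)
    have "(\<integral>\<^sup>+w. G p w \<partial>weight_space n) = ennreal r *
         (\<integral>\<^sup>+w. ennreal (exp (- t * conn_cost n w (insert v U))) \<partial>weight_space n)"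
      unfolding G_def r_def k_def uv(1) ed_def fst_conv snd_conv
      using uv Suc.prems by (intro exp_moment_cheapest_edge)
    also have "\<dots> \<le> ennreal r * ennreal (\<Prod>i\<in>{card (insert v U)..<n}. real i / (real i + t))"
      using uv Suc.prems Suc.hyps(2) c
      by (intro mult_left_mono Suc.hyps(1)) (auto simp: k_def)
    also have "\<dots> = ennreal (r * Q)" using r0 Q0 by (simp add: c Q_def ennreal_mult)
    finally show ?thesis .
  qed
  have "(\<integral>\<^sup>+w. ennreal (exp (- t * conn_cost n w U)) \<partial>weight_space n)
      \<le> (\<integral>\<^sup>+w. (\<Sum>p\<in>P. G p w) \<partial>weight_space n)"
  proof (rule nn_integral_mono)
    fix w :: "nat \<times> nat \<Rightarrow> real"
    \<comment> \<open>Some cut edge is always cheapest; ties are counted several times, which only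
      enlarges the sum.\<close>
    obtain p where p: "p \<in> P" "\<forall>q\<in>P. w (ed p) \<le> w (ed q)"
      using ex_min_if_finite[of "(w \<circ> ed) ` P"] finP \<open>P \<noteq> {}\<close> by (auto simp: not_less)
    then have "ennreal (exp (- t * conn_cost n w U)) = G p w"
      by (auto simp: G_def cut)
    also have "\<dots> \<le> (\<Sum>p\<in>P. G p w)" using p finP by (intro member_le_sum) auto
    finally show "ennreal (exp (- t * conn_cost n w U)) \<le> (\<Sum>p\<in>P. G p w)" .
  qed
  also have "\<dots> = (\<Sum>p\<in>P. \<integral>\<^sup>+w. G p w \<partial>weight_space n)"
    using mG by (intro nn_integral_sum) auto
  also have "\<dots> \<le> (\<Sum>p\<in>P. ennreal (r * Q))" using one by (intro sum_mono) auto
  also have "\<dots> = ennreal (real (card P) * (r * Q))"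
    using r0 Q0 by (simp add: ennreal_of_nat_eq_real_of_nat ennreal_mult[symmetric])
  also have "real (card P) * (r * Q) = real k / (real k + t) * Q"
    using kn by (simp add: cardP r_def of_nat_diff)
  also have "\<dots> = (\<Prod>i\<in>{k..<n}. real i / (real i + t))"
    using kn by (simp add: Q_def prod.atLeast_Suc_lessThan)
  finally show ?case by (simp add: k_def)
qed

section \<open>Elementary estimates for the moment products and the union bound\<close>

lemma prod_telescope_shift:
  assumes "1 \<le> k" "k \<le> n" "0 \<le> (T::real)"
  shows "(\<Prod>i\<in>{k..<n}. (real i + T) / (real i + T + 1)) = (real k + T) / (real n + T)"
  using assms(2)
proof (induction n rule: dec_induct)
  case base
  then show ?case using assms by simp
next
  case (step n)
  then show ?case using assms by (simp add: prod.atLeastLessThan_Suc field_simps)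
qed

text \<open>Raising \<open>T\<close> by one multiplies the product by the telescoping value
  \<open>(k + T) / (n + T)\<close>. The fixed \<open>S\<close> bounds all these factors by the same
  number \<open>(k + S) / n\<close>.\<close>

lemma prod_ratio_le_power:
  assumes "1 \<le> k" "k \<le> n" "T \<le> S"
  shows "(\<Prod>i\<in>{k..<n}. real i / (real i + real T)) \<le> ((real k + real S) / real n) ^ T"
  using assms(3)
proof (induction T)
  case 0
  have "(\<Prod>i\<in>{k..<n}. real i / (real i + real 0)) = 1"
    using assms by (intro prod.neutral) auto
  then show ?case by simp
next
  case (Suc T)
  have "(\<Prod>i\<in>{k..<n}. real i / (real i + real (Suc T)))
      = (\<Prod>i\<in>{k..<n}. real i / (real i + real T)) * ((real k + real T) / (real n + real T))"
    using assms by (subst prod_telescope_shift[symmetric]; simp flip: prod.distrib)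
      (auto intro!: prod.cong simp: add_ac)
  also have "\<dots> \<le> ((real k + real S) / real n) ^ T * ((real k + real S) / real n)"
    using Suc assms by (intro mult_mono frac_le) auto
  finally show ?case by (simp add: mult.commute)
qed

text \<open>For \<open>m \<ge> 2\<close> the squared factor is at most \<open>m / (m - 1)\<close>,
  which telescopes. The factor at \<open>k\<close>, where \<open>k = 1\<close> is possible, is
  bounded by 2 instead; hence the induction starts at \<open>Suc k\<close> and the constant is 4
  before taking roots.\<close>

lemma prod_half_le_sqrt:
  assumes "1 \<le> k" "k < n"
  shows "(\<Prod>i\<in>{k..<n}. real i / (real i - 1/2)) \<le> 2 * sqrt (real n / real k)"
proof -
  have "(\<Prod>i\<in>{k..<n}. real i / (real i - 1/2))\<^sup>2 \<le> 4 * (real n - 1) / real k"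
    using Suc_leI[OF assms(2)]
  proof (induction n rule: dec_induct)
    case base
    have "real k / (real k - 1/2) \<le> 2" using assms by (simp add: field_simps)
    then have "(real k / (real k - 1/2))\<^sup>2 \<le> 2\<^sup>2"
      using assms by (intro power_mono) auto
    then show ?case using assms by simp
  next
    case (step m)
    have m: "2 \<le> real m" using step(1) assms by simp
    have "(real m / (real m - 1/2))\<^sup>2 \<le> real m / (real m - 1)"
      using m by (simp add: power_divide divide_simps power2_eq_square) (simp add: algebra_simps)
    then have "(\<Prod>i\<in>{k..<m}. real i / (real i - 1/2))\<^sup>2 * (real m / (real m - 1/2))\<^sup>2
        \<le> (4 * (real m - 1) / real k) * (real m / (real m - 1))"
      using step m by (intro mult_mono) auto
    also have "\<dots> = 4 * (real (Suc m) - 1) / real k" using m assms by (simp add: field_simps)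
    finally show ?case using step(1)
      by (simp only: prod.atLeastLessThan_Suc[OF Suc_leD[OF step(1)]] power_mult_distrib)
  qed
  also have "\<dots> \<le> 4 * (real n / real k)" by (simp add: divide_right_mono)
  finally have "(\<Prod>i\<in>{k..<n}. real i / (real i - 1/2)) \<le> sqrt (4 * (real n / real k))"
    by (rule real_le_rsqrt)
  then show ?thesis by (simp only: real_sqrt_mult real_sqrt_four)
qed

text \<open>The \<open>k\<close>-th term of the exponential series at \<open>k\<close> is at most
  the whole sum.\<close>

lemma power_le_fact_mult_exp: "real k ^ k \<le> fact k * exp (real k)"
proof -
  have "real k ^ k /\<^sub>R fact k \<le> (\<Sum>n. real k ^ n /\<^sub>R fact n)"
    using sum_le_suminf[OF summable_exp_generic[of "real k"], of "{k}"] by simp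
  then show ?thesis by (simp add: exp_def divide_simps mult.commute)
qed

text \<open>The usual bound \<open>(e * n / k) ^ k\<close> in exponential form.\<close>

lemma binomial_le_exp:
  assumes "1 \<le> k" "k \<le> n"
  shows "real (n choose k) \<le> exp (real k * (1 + ln (real n / real k)))"
proof -
  have "real (n choose k) * fact k \<le> real n ^ k"
    using binomial_fact_pow[of n k] by (metis of_nat_fact of_nat_le_iff of_nat_mult of_nat_power)
  also have "\<dots> = (real n / real k) ^ k * real k ^ k"
    using assms by (simp add: power_divide)
  also have "\<dots> \<le> (real n / real k) ^ k * (fact k * exp (real k))"
    by (intro mult_left_mono power_le_fact_mult_exp) auto
  finally have "real (n choose k) \<le> (real n / real k) ^ k * exp (real k)"
    by (simp add: mult.left_commute[of "(real n / real k) ^ k"] mult.commute[of _ "fact k"])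
  also have "(real n / real k) ^ k = exp (real k * ln (real n / real k))"
    using assms by (simp add: exp_of_nat_mult)
  finally show ?thesis by (simp add: exp_add[symmetric] algebra_simps)
qed

text \<open>Equivalent to \<open>n \<le> (n / k) ^ k\<close>, which follows from
  \<open>k \<le> 2 ^ (k - 1) \<le> (n / k) ^ (k - 1)\<close>. It turns decay in
  \<open>k * ln (n / k)\<close> into a negative power of \<open>n\<close>, uniformly in
  \<open>k\<close>.\<close>

lemma ln_le_mult_ln_div:
  assumes "1 \<le> k" "2 * k \<le> n"
  shows "ln (real n) \<le> real k * ln (real n / real k)"
proof -
  have "k \<le> 2 ^ (k - 1)" using assms less_exp[of "k - 1"] by linarith
  then have "real k \<le> 2 ^ (k - 1)" by (metis of_nat_le_iff of_nat_numeral of_nat_power)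
  also have "\<dots> \<le> (real n / real k) ^ (k - 1)"
    using assms by (intro power_mono) (auto simp: field_simps)
  finally have "real n / real k * real k \<le> real n / real k * (real n / real k) ^ (k - 1)"
    by (intro mult_left_mono) auto
  also have "\<dots> = (real n / real k) ^ k" using assms by (simp flip: power_Suc)
  finally have "real n \<le> (real n / real k) ^ k" using assms by simp
  then have "ln (real n) \<le> ln ((real n / real k) ^ k)" using assms by simp
  then show ?thesis using assms by (simp add: ln_realpow)
qed

text \<open>Divided by \<open>k\<close>, the exponent is at most
  \<open>1 + C * ln (1 + C) + L - C * \<epsilon> * L\<close>. Of the \<open>A + 2\<close> multiples
  of \<open>L\<close> that are subtracted, one pays for the number of sets, one for the constants,
  and the remaining \<open>A\<close> give \<open>n\<close> to the power \<open>- A\<close>.\<close>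

lemma union_bound_exponent:
  fixes \<epsilon> :: real and k n C A :: nat
  defines "L \<equiv> ln (real n / real k)"
  assumes k: "1 \<le> k" "k \<le> n" and C: "real A + 2 \<le> real C * \<epsilon>"
    and L: "real C * ln (1 + real C) + 1 \<le> L"
  shows "real (n choose k) * (exp (real (C * k) * ((1 - \<epsilon>) * L)) *
           ((real k + real (C * k)) / real n) ^ (C * k)) \<le> 1 / real n ^ A"
proof -
  have L1: "1 \<le> L" using L by (smt (verit) ln_ge_zero mult_nonneg_nonneg of_nat_0_le_iff)
  have "(2::real) \<le> exp 1" using exp_ge_add_one_self[of 1] by simp
  then have "2 \<le> exp L" using L1 by (smt (verit) exp_le_cancel_iff)
  then have "2 * k \<le> n" using k by (simp add: L_def field_simps)
  then have lnn: "ln (real n) \<le> real k * L" unfolding L_def using k by (intro ln_le_mult_ln_div)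
  have "(real k + real (C * k)) / real n = exp (ln (1 + real C) - L)"
    using k by (simp add: L_def exp_diff field_simps)
  then have pw: "((real k + real (C * k)) / real n) ^ (C * k) = exp (real (C * k) * (ln (1 + real C) - L))"
    by (simp only: exp_of_nat_mult)
  have "real (n choose k) * (exp (real (C * k) * ((1 - \<epsilon>) * L)) *
           ((real k + real (C * k)) / real n) ^ (C * k))
      \<le> exp (real k * (1 + L)) * (exp (real (C * k) * ((1 - \<epsilon>) * L)) *
           exp (real (C * k) * (ln (1 + real C) - L)))"
    unfolding pw L_def by (intro mult_right_mono binomial_le_exp k) auto
  also have "\<dots> = exp (real k * ((1 + real C * ln (1 + real C)) + L - (real C * \<epsilon>) * L))"
    by (simp add: exp_add[symmetric] algebra_simps)
  also have "\<dots> \<le> exp (- real A * ln (real n))"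
  proof -
    have "(real A + 2) * L \<le> (real C * \<epsilon>) * L" using C L1 by (intro mult_right_mono) auto
    then have "(1 + real C * ln (1 + real C)) + L - (real C * \<epsilon>) * L \<le> - (real A * L)"
      using L by (simp add: algebra_simps)
    then have "real k * ((1 + real C * ln (1 + real C)) + L - (real C * \<epsilon>) * L) \<le> real k * - (real A * L)"
      by (intro mult_left_mono) auto
    also have "\<dots> = - (real A * (real k * L))" by simp
    also have "\<dots> \<le> - real A * ln (real n)" using mult_left_mono[OF lnn, of "real A"] by simp
    finally show ?thesis by simp
  qed
  also have "\<dots> = 1 / real n ^ A" using k
    by (simp add: exp_minus exp_of_nat_mult inverse_eq_divide)
  finally show ?thesis .
qed

section \<open>The optimal cost\<close>

lemma kappa_in:
  assumes "1 \<le> n"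
  shows "kappa n f \<in> {i \<in> {1..n}. i = 1 \<or> f i < 1 / real (i - 1)}"
  unfolding kappa_def using assms by (intro Max_in) auto

lemma kappa_greatest:
  assumes "kappa n f < i" "i \<le> n"
  shows "1 / real (i - 1) \<le> f i"
proof (rule ccontr)
  assume "\<not> ?thesis"
  then have "i \<le> kappa n f" unfolding kappa_def using assms by (intro Max_ge) auto
  then show False using assms by simp
qed

text \<open>Subtract \<theta> from every cost: the indices up to \<open>k\<close> then have
  nonpositive terms and the later ones nonnegative terms, so \<open>{1..k}\<close> minimizes the
  sum.\<close>

lemma sum_threshold_le:
  fixes f :: "nat \<Rightarrow> real"
  assumes U: "U \<subseteq> {1..n}"
    and lo: "\<And>i. 1 \<le> i \<Longrightarrow> i \<le> k \<Longrightarrow> f i \<le> \<theta>" and hi: "\<And>i. k < i \<Longrightarrow> i \<le> n \<Longrightarrow> \<theta> \<le> f i"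
  shows "(\<Sum>i=1..k. f i) + (real (card U) - real k) * \<theta> \<le> (\<Sum>i\<in>U. f i)"
proof -
  have fin: "finite U" using U finite_subset by blast
  have "(\<Sum>i=1..k. f i - \<theta>) \<le> (\<Sum>i\<in>U \<inter> {1..k}. f i - \<theta>)"
  proof -
    have "(\<Sum>i\<in>U \<inter> {1..k}. \<theta> - f i) \<le> (\<Sum>i=1..k. \<theta> - f i)"
      using lo by (intro sum_mono2) auto
    then show ?thesis by (simp add: sum_subtractf)
  qed
  also have "\<dots> \<le> (\<Sum>i\<in>U. f i - \<theta>)"
    using fin hi U by (intro sum_mono2) (auto simp: subset_eq)
  finally show ?thesis by (simp add: sum_subtractf algebra_simps)
qed

text \<open>Around \<open>kappa\<close> the price of one facility is about \<open>1 / kappa\<close>.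
  Opening fewer therefore saves at most 1, and opening more costs at least the logarithm of the
  ratio, by \<open>ln x \<le> x - 1\<close>.\<close>

lemma opening_cost_ge:
  assumes pos: "\<And>i. 1 \<le> i \<Longrightarrow> i \<le> n \<Longrightarrow> f i > 0"
    and mono: "\<And>i j. 1 \<le> i \<Longrightarrow> i \<le> j \<Longrightarrow> j \<le> n \<Longrightarrow> f i \<le> f j"
    and kn: "kappa n f < n" and U: "U \<subseteq> {1..n}" "U \<noteq> {}"
  shows "card U \<le> kappa n f \<Longrightarrow> (\<Sum>i=1..kappa n f. f i) - 1 \<le> (\<Sum>i\<in>U. f i)"
    and "kappa n f \<le> card U \<Longrightarrow>
      (\<Sum>i=1..kappa n f. f i) + ln (real (card U) / real (kappa n f)) \<le> (\<Sum>i\<in>U. f i)"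
proof -
  define k where "k = kappa n f"
  \<comment> \<open>This value separates the first \<open>k\<close> costs from the others, as
    \<open>f (k + 1) \<ge> 1 / k\<close> by maximality of \<open>kappa\<close>. It is at least
    \<open>1 / k\<close> and, for \<open>k \<ge> 2\<close>, at most
    \<open>1 / (k - 1)\<close>.\<close>
  define \<theta> where "\<theta> = max (f k) (1 / real k)"
  have fin: "finite U" using U finite_subset by blast
  have k: "1 \<le> k" "k = 1 \<or> f k < 1 / real (k - 1)" "k < n"
    using kappa_in[of n f] kn by (auto simp: k_def)
  have "\<theta> \<le> f (Suc k)"
    using kappa_greatest[of n f "Suc k"] k mono[of k "Suc k"] by (auto simp: \<theta>_def k_def)
  then have "\<theta> \<le> f i" if "k < i" "i \<le> n" for i
    using mono[of "Suc k" i] that by auto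
  moreover have "f i \<le> \<theta>" if "1 \<le> i" "i \<le> k" for i
    using mono[of i k] that k by (auto simp: \<theta>_def)
  ultimately have ge: "(\<Sum>i=1..k. f i) + (real (card U) - real k) * \<theta> \<le> (\<Sum>i\<in>U. f i)"
    using U by (intro sum_threshold_le) auto
  have card: "1 \<le> card U" using fin U by (simp add: Suc_le_eq card_gt_0_iff)
  { assume le: "card U \<le> kappa n f"
    have "(real k - real (card U)) * \<theta> \<le> 1"
    \<comment> \<open>For \<open>k = 1\<close> nothing bounds \<open>f 1\<close> from above, but
      then \<open>card U = 1\<close> and the left-hand side vanishes.\<close>
    proof (cases "k = 1")
      case True
      then show ?thesis using card le by (simp add: k_def)
    next
      case False
      then have k2: "2 \<le> k" using k by simp
      have "(real k - real (card U)) * \<theta> \<le> (real k - 1) * (1 / (real k - 1))"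
        using k k2 card le pos[of k] False
        by (intro mult_mono) (auto simp: \<theta>_def k_def of_nat_diff frac_le)
      then show ?thesis using k2 by simp
    qed
    then show "(\<Sum>i=1..kappa n f. f i) - 1 \<le> (\<Sum>i\<in>U. f i)"
      using ge by (simp add: k_def algebra_simps) }
  { assume le: "kappa n f \<le> card U"
    have "ln (real (card U) / real k) \<le> real (card U) / real k - 1"
      using card k by (intro ln_le_minus_one) auto
    also have "\<dots> = (real (card U) - real k) * (1 / real k)" using k by (simp add: field_simps)
    also have "\<dots> \<le> (real (card U) - real k) * \<theta>"
      using le by (intro mult_left_mono) (auto simp: \<theta>_def k_def)
    finally show "(\<Sum>i=1..kappa n f. f i) + ln (real (card U) / real (kappa n f)) \<le> (\<Sum>i\<in>U. f i)"
      using ge by (simp add: k_def) }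
qed

section \<open>Lower bounds for the optimum\<close>

lemma fl_opt_geI:
  assumes "1 \<le> n" "\<And>U. U \<subseteq> {1..n} \<Longrightarrow> U \<noteq> {} \<Longrightarrow> c \<le> fl_cost n f w U"
  shows "c \<le> fl_opt n f w"
proof -
  have "finite {U. U \<subseteq> {1..n} \<and> U \<noteq> {}}"
    by (rule finite_subset[of _ "Pow {1..n}"]) auto
  moreover have "{1} \<in> {U. U \<subseteq> {1..n} \<and> U \<noteq> {}}" using assms by auto
  ultimately show ?thesis unfolding fl_opt_def using assms(2)
    by (subst Min_ge_iff) (auto simp del: mem_Collect_eq)
qed

lemma fl_opt_le_alg:
  assumes "1 \<le> n"
  shows "fl_opt n f w \<le> fl_alg n f w"
proof -
  have "finite {U. U \<subseteq> {1..n} \<and> U \<noteq> {}}"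
    by (rule finite_subset[of _ "Pow {1..n}"]) auto
  then show ?thesis unfolding fl_opt_def fl_alg_def using kappa_in[OF assms, of f]
    by (intro Min_le) auto
qed

lemma fl_opt_ge_cheapest:
  assumes pos: "\<And>i. 1 \<le> i \<Longrightarrow> i \<le> n \<Longrightarrow> f i > 0"
    and mono: "\<And>i j. 1 \<le> i \<Longrightarrow> i \<le> j \<Longrightarrow> j \<le> n \<Longrightarrow> f i \<le> f j"
    and n: "1 \<le> n" and w: "\<forall>e\<in>edges n. 0 \<le> w e"
  shows "f 1 \<le> fl_opt n f w"
proof (rule fl_opt_geI[OF n])
  fix U assume U: "U \<subseteq> {1..n}" "U \<noteq> {}"
  then obtain i where i: "i \<in> U" by auto
  have in1n: "1 \<le> j" "j \<le> n" if "j \<in> U" for j using that U by auto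
  have "f 1 \<le> f i" using mono[of 1 i] in1n[OF i] by blast
  also have "\<dots> \<le> (\<Sum>i\<in>U. f i)"
  proof (rule member_le_sum[OF i])
    show "0 \<le> f j" if "j \<in> U - {i}" for j using pos[of j] in1n[of j] that by fastforce
    show "finite U" using U(1) finite_subset by blast
  qed
  finally show "f 1 \<le> fl_cost n f w U"
    using conn_cost_nonneg[OF w U] by (simp add: fl_cost_conn)
qed

text \<open>Opening \<open>k \<ge> kappa\<close> facilities costs at least \<open>ln (k / kappa)\<close> extra, which compensates the
  smaller connection cost \<open>ln (n / k)\<close>; sets larger than \<open>\<delta> n\<close> need no connection cost at all.\<close>

lemma fl_opt_ge:
  assumes pos: "\<And>i. 1 \<le> i \<Longrightarrow> i \<le> n \<Longrightarrow> f i > 0"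
    and mono: "\<And>i j. 1 \<le> i \<Longrightarrow> i \<le> j \<Longrightarrow> j \<le> n \<Longrightarrow> f i \<le> f j"
    and kn: "kappa n f < n" and w: "\<forall>e\<in>edges n. 0 \<le> w e"
    and \<epsilon>: "0 \<le> \<epsilon>" "\<epsilon> \<le> 1" and K: "1 \<le> K" and \<delta>: "\<delta> = exp (- K)" "real (kappa n f) \<le> \<delta> * real n"
    and good: "\<And>U. U \<subseteq> {1..n} \<Longrightarrow> U \<noteq> {} \<Longrightarrow> real (card U) \<le> \<delta> * real n \<Longrightarrow>
       (1 - \<epsilon>) * ln (real n / real (card U)) \<le> conn_cost n w U"
  shows "(\<Sum>i=1..kappa n f. f i) + (1 - \<epsilon>) * ln (real n / real (kappa n f)) - K \<le> fl_opt n f w"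
proof (rule fl_opt_geI)
  show "1 \<le> n" using kn by simp
  fix U assume U: "U \<subseteq> {1..n}" "U \<noteq> {}"
  define k where "k = kappa n f"
  have k: "1 \<le> k" using kappa_in[of n f] kn by (auto simp: k_def)
  have n: "0 < real n" using kn by simp
  have fin: "finite U" using U finite_subset by blast
  have card: "1 \<le> card U" using fin U by (simp add: Suc_le_eq card_gt_0_iff)
  \<comment> \<open>The saving of 1 is covered by the slack \<open>K \<ge> 1\<close>.\<close>
  have open1: "card U \<le> k \<Longrightarrow> (\<Sum>i=1..k. f i) - 1 \<le> (\<Sum>i\<in>U. f i)"
    unfolding k_def using pos mono by (intro opening_cost_ge(1)[OF _ _ kn U]) auto
  have open2: "k \<le> card U \<Longrightarrow>
      (\<Sum>i=1..k. f i) + ln (real (card U) / real k) \<le> (\<Sum>i\<in>U. f i)"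
    unfolding k_def using pos mono by (intro opening_cost_ge(2)[OF _ _ kn U]) auto
  have D0: "0 \<le> conn_cost n w U" by (rule conn_cost_nonneg[OF w U])
  have lnU: "ln (real n / real (card U)) = ln n - ln (card U)" 
    and lnUk: "ln (real (card U) / real k) = ln (card U) - ln k"
    and lnk: "ln (real n / real k) = ln n - ln k"
    using card k n by (simp_all add: ln_div)
  have lnkn: "ln (real k) \<le> ln (real n)" using k kn by (simp add: k_def)
  show "(\<Sum>i=1..kappa n f. f i) + (1 - \<epsilon>) * ln (real n / real (kappa n f)) - K \<le> fl_cost n f w U"
    unfolding fl_cost_conn k_def[symmetric]
  proof (cases "card U \<le> k")
    case True
    have "(1 - \<epsilon>) * ln (real n / real (card U)) \<le> conn_cost n w U"
      using True \<delta> by (intro good U) (auto simp: k_def)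
    moreover have "(1 - \<epsilon>) * ln (real n / real k) \<le> (1 - \<epsilon>) * ln (real n / real (card U))"
      unfolding lnU lnk using \<epsilon> card True by (intro mult_left_mono) auto
    ultimately show "(\<Sum>i=1..k. f i) + (1 - \<epsilon>) * ln (real n / real k) - K
        \<le> (\<Sum>i\<in>U. f i) + conn_cost n w U"
      using open1[OF True] K by linarith
  next
    case False
    then have kU: "k \<le> card U" by simp
    have lnkU: "ln (real k) \<le> ln (real (card U))" using k kU by simp
    show "(\<Sum>i=1..k. f i) + (1 - \<epsilon>) * ln (real n / real k) - K
        \<le> (\<Sum>i\<in>U. f i) + conn_cost n w U"
    proof (cases "real (card U) \<le> \<delta> * real n")
      case True
      have "(1 - \<epsilon>) * ln (real n / real (card U)) \<le> conn_cost n w U"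
        using True by (intro good U)
      moreover have "(1 - \<epsilon>) * ln (real (card U) / real k) \<le> ln (real (card U) / real k)"
        unfolding lnUk using \<epsilon> lnkU by (intro mult_left_le_one_le) auto
      moreover have "(1 - \<epsilon>) * ln (real n / real k) =
          (1 - \<epsilon>) * ln (real n / real (card U)) + (1 - \<epsilon>) * ln (real (card U) / real k)"
        unfolding lnU lnk lnUk by (simp add: algebra_simps)
      ultimately show ?thesis using open2[OF kU] K by linarith
    next
      case False
      \<comment> \<open>For more than \<open>\<delta> * n\<close> facilities the opening costs alone
        suffice: the unserved part \<open>ln (n / card U)\<close> is less than
        \<open>- ln \<delta> = K\<close>.\<close>
      have "ln (\<delta> * real n) \<le> ln (real (card U))" using False n card \<delta>(1) by simp
      then have "ln n - K \<le> ln (card U)" using n \<delta>(1) by (simp add: ln_mult)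
      moreover have "(1 - \<epsilon>) * ln (real n / real k) \<le> ln (real n / real k)"
        unfolding lnk using \<epsilon> lnkn by (intro mult_left_le_one_le) auto
      ultimately show ?thesis using open2[OF kU] D0 lnk lnUk by linarith
    qed
  qed
qed

text \<open>A crude bound for exceptional weights, from \<open>OPT \<ge> f 1\<close>. Since
  \<open>kappa < n\<close> forces \<open>f n \<ge> 1 / (n - 1)\<close>, the bound on
  \<open>f n / f 1\<close> also makes \<open>1 / f 1\<close> polynomially bounded.\<close>

lemma alg_opt_ratio_le:
  assumes pos: "\<And>i. 1 \<le> i \<Longrightarrow> i \<le> n \<Longrightarrow> f i > 0"
    and mono: "\<And>i j. 1 \<le> i \<Longrightarrow> i \<le> j \<Longrightarrow> j \<le> n \<Longrightarrow> f i \<le> f j"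
    and kn: "kappa n f < n" and w: "\<forall>e\<in>edges n. 0 \<le> w e"
    and ratio: "f n / f 1 \<le> real n ^ q"
  shows "fl_alg n f w / fl_opt n f w \<le> real n ^ (q + 1) * (1 + conn_cost n w {1..kappa n f})"
proof -
  define k where "k = kappa n f"
  define D where "D = conn_cost n w {1..k}"
  have k: "1 \<le> k" "k < n" using kappa_in[of n f] kn by (auto simp: k_def)
  have f1: "0 < f 1" "0 < f n" using pos[of 1] pos[of n] k by auto
  have D0: "0 \<le> D" unfolding D_def using k by (intro conn_cost_nonneg w) auto
  have F: "(\<Sum>i=1..k. f i) / f 1 \<le> real n ^ (q + 1)"
  proof -
    have "(\<Sum>i=1..k. f i) \<le> (\<Sum>i=1..k. f n)" using mono k by (intro sum_mono) auto
    also have "\<dots> \<le> real n * f n" using k f1 by simp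
    finally have "(\<Sum>i=1..k. f i) / f 1 \<le> real n * f n / f 1" using f1 by (intro divide_right_mono) auto
    also have "\<dots> = real n * (f n / f 1)" by simp
    also have "\<dots> \<le> real n * real n ^ q" using ratio by (intro mult_left_mono) auto
    finally show ?thesis by simp
  qed
  have G: "1 / f 1 \<le> real n ^ (q + 1)"
  proof -
    have "1 / real (n - 1) \<le> f n" using kappa_greatest[OF kn] k by simp
    then have "1 \<le> f n * real (n - 1)" using k by (simp add: pos_divide_le_eq)
    also have "\<dots> \<le> f n * real n" using f1 by (intro mult_left_mono) auto
    finally have "1 / f 1 \<le> f n * real n / f 1" using f1 by (intro divide_right_mono) auto
    also have "\<dots> = real n * (f n / f 1)" by simp
    also have "\<dots> \<le> real n * real n ^ q" using ratio by (intro mult_left_mono) auto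
    finally show ?thesis by simp
  qed
  have alg: "fl_alg n f w = (\<Sum>i=1..k. f i) + D" by (simp add: fl_alg_def fl_cost_conn k_def D_def)
  have F0: "0 \<le> (\<Sum>i=1..k. f i)" using pos k by (intro sum_nonneg) (auto intro!: less_imp_le)
  have "f 1 \<le> fl_opt n f w" using pos mono k by (intro fl_opt_ge_cheapest[OF _ _ _ w]) auto
  then have "fl_alg n f w / fl_opt n f w \<le> fl_alg n f w / f 1"
    using f1 F0 D0 unfolding alg by (intro frac_le) auto
  also have "\<dots> = (\<Sum>i=1..k. f i) / f 1 + 1 / f 1 * D" unfolding alg by (simp add: add_divide_distrib)
  also have "\<dots> \<le> real n ^ (q + 1) + real n ^ (q + 1) * D"
    using F G D0 by (intro add_mono mult_right_mono) auto
  finally show ?thesis by (simp add: D_def k_def algebra_simps)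
qed

section \<open>The expected ratio\<close>

text \<open>The left-hand side dominates the probability that some small set of facilities has an
  unusually small connection cost.\<close>

lemma chernoff_union_bound:
  fixes \<epsilon> :: real and n C A :: nat
  assumes n: "1 \<le> n" and C: "real A + 2 \<le> real C * \<epsilon>"
    and K: "K = real C * ln (1 + real C) + 1"
  shows "(\<integral>\<^sup>+w. ennreal (\<Sum>U | U \<subseteq> {1..n} \<and> U \<noteq> {} \<and> real (card U) \<le> exp (- K) * real n.
      exp (real (C * card U) * ((1 - \<epsilon>) * ln (real n / real (card U)) - conn_cost n w U))) \<partial>weight_space n)
    \<le> ennreal (real n * (1 / real n ^ A))"
proof -
  define \<U> where "\<U> = {U. U \<subseteq> {1..n} \<and> U \<noteq> {} \<and> real (card U) \<le> exp (- K) * real n}"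
  define S where "S = {k \<in> {1..n}. real k \<le> exp (- K) * real n}"
  \<comment> \<open>The exponential Markov bound for a single set of size \<open>k\<close>, with
    parameter \<open>t = C * k\<close>.\<close>
  define b where "b k = exp (real (C * k) * ((1 - \<epsilon>) * ln (real n / real k))) *
           ((real k + real (C * k)) / real n) ^ (C * k)" for k
  have fin\<U>: "finite \<U>" by (rule finite_subset[of _ "Pow {1..n}"]) (auto simp: \<U>_def)
  have b0: "0 \<le> b k" for k by (auto simp: b_def)
  have card\<U>: "card U \<in> S" if "U \<in> \<U>" for U
  proof -
    have U: "U \<subseteq> {1..n}" using that by (simp add: \<U>_def)
    have "finite U" "card U \<le> n" using finite_subset[OF U] card_mono[OF _ U] by simp_all
    then show ?thesis using that by (auto simp: \<U>_def S_def Suc_le_eq card_gt_0_iff)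
  qed
  have one: "(\<integral>\<^sup>+w. ennreal (exp (real (C * card U) * ((1 - \<epsilon>) * ln (real n / real (card U)) - conn_cost n w U)))
      \<partial>weight_space n) \<le> ennreal (b (card U))" if U: "U \<in> \<U>" for U
  proof -
    define k where "k = card U"
    have k: "1 \<le> k" "k \<le> n" using card\<U>[OF U] by (auto simp: S_def k_def)
    have U': "U \<subseteq> {1..n}" "U \<noteq> {}" using U by (auto simp: \<U>_def)
    have "(\<integral>\<^sup>+w. ennreal (exp (real (C * k) * ((1 - \<epsilon>) * ln (real n / real k) - conn_cost n w U))) \<partial>weight_space n)
      = (\<integral>\<^sup>+w. ennreal (exp (real (C * k) * ((1 - \<epsilon>) * ln (real n / real k)))) *
            ennreal (exp (- real (C * k) * conn_cost n w U)) \<partial>weight_space n)"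
      by (intro nn_integral_cong)
         (simp add: ennreal_mult[symmetric] exp_add[symmetric] algebra_simps)
    also have "\<dots> = ennreal (exp (real (C * k) * ((1 - \<epsilon>) * ln (real n / real k)))) *
        (\<integral>\<^sup>+w. ennreal (exp (- real (C * k) * conn_cost n w U)) \<partial>weight_space n)"
      using measurable_conn_cost[OF U'(1)] by (intro nn_integral_cmult) measurable
    also have "\<dots> \<le> ennreal (exp (real (C * k) * ((1 - \<epsilon>) * ln (real n / real k)))) *
        ennreal (\<Prod>i\<in>{card U..<n}. real i / (real i + real (C * k)))"
      using k by (intro mult_left_mono exp_moment_conn_cost U') (auto simp: k_def add_pos_nonneg)
    also have "\<dots> \<le> ennreal (exp (real (C * k) * ((1 - \<epsilon>) * ln (real n / real k)))) *
        ennreal (((real k + real (C * k)) / real n) ^ (C * k))"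
      unfolding k_def[symmetric] using k
      by (intro mult_left_mono ennreal_leI prod_ratio_le_power) auto
    also have "\<dots> = ennreal (b k)" by (simp add: b_def ennreal_mult)
    finally show ?thesis by (simp add: k_def)
  qed
  have "(\<integral>\<^sup>+w. ennreal (\<Sum>U\<in>\<U>. exp (real (C * card U) *
        ((1 - \<epsilon>) * ln (real n / real (card U)) - conn_cost n w U))) \<partial>weight_space n)
    = (\<integral>\<^sup>+w. (\<Sum>U\<in>\<U>. ennreal (exp (real (C * card U) *
        ((1 - \<epsilon>) * ln (real n / real (card U)) - conn_cost n w U)))) \<partial>weight_space n)"
    by (subst sum_ennreal) auto
  also have "\<dots> = (\<Sum>U\<in>\<U>. \<integral>\<^sup>+w. ennreal (exp (real (C * card U) *
        ((1 - \<epsilon>) * ln (real n / real (card U)) - conn_cost n w U))) \<partial>weight_space n)"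
  proof (rule nn_integral_sum)
    fix U assume "U \<in> \<U>"
    then have [measurable]: "(\<lambda>w. conn_cost n w U) \<in> borel_measurable (weight_space n)"
      by (intro measurable_conn_cost) (auto simp: \<U>_def)
    show "(\<lambda>w. ennreal (exp (real (C * card U) *
        ((1 - \<epsilon>) * ln (real n / real (card U)) - conn_cost n w U)))) \<in> borel_measurable (weight_space n)"
      by measurable
  qed
  also have "\<dots> \<le> (\<Sum>U\<in>\<U>. ennreal (b (card U)))" by (intro sum_mono one)
  also have "\<dots> = ennreal (\<Sum>U\<in>\<U>. b (card U))" using b0 by (simp add: sum_ennreal)
  also have "\<dots> \<le> ennreal (real n * (1 / real n ^ A))"
  proof (rule ennreal_leI)
    \<comment> \<open>Grouping by cardinality: each size contributes at most
      \<open>1 / n ^ A\<close>, and there are at most \<open>n\<close> sizes.\<close>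
    have "(\<Sum>U\<in>\<U>. b (card U)) = (\<Sum>k\<in>S. \<Sum>U\<in>{U\<in>\<U>. card U = k}. b (card U))"
    proof (rule sum.group[symmetric, OF fin\<U>])
      show "finite S" by (simp add: S_def)
      show "card ` \<U> \<subseteq> S" using card\<U> by blast
    qed
    also have "\<dots> \<le> (\<Sum>k\<in>S. 1 / real n ^ A)"
    proof (rule sum_mono)
      fix k assume k: "k \<in> S"
      have "card {U\<in>\<U>. card U = k} \<le> card {U. U \<subseteq> {1..n} \<and> card U = k}"
        by (rule card_mono) (auto simp: \<U>_def intro: finite_subset[of _ "Pow {1..n}"])
      also have "\<dots> = n choose k" using n_subsets[of "{1..n}" k] by simp
      finally have "(\<Sum>U\<in>{U\<in>\<U>. card U = k}. b (card U)) \<le> real (n choose k) * b k"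
        using b0 by (simp add: mult_right_mono)
      also have "\<dots> \<le> 1 / real n ^ A"
        unfolding b_def
      proof (rule union_bound_exponent[OF _ _ C])
        show k1: "1 \<le> k" "k \<le> n" using k by (auto simp: S_def)
        have "exp K \<le> real n / real k" using k k1 by (simp add: S_def exp_minus field_simps)
        then show "real C * ln (1 + real C) + 1 \<le> ln (real n / real k)"
          using k1 n by (simp add: K[symmetric] ln_ge_iff)
      qed
      finally show "(\<Sum>U\<in>{U\<in>\<U>. card U = k}. b (card U)) \<le> 1 / real n ^ A" .
    qed
    also have "\<dots> = real (card S) * (1 / real n ^ A)" by simp
    also have "\<dots> \<le> real n * (1 / real n ^ A)"
    proof (rule mult_right_mono)
      have "card S \<le> card {1..n}" by (intro card_mono) (auto simp: S_def)
      then show "real (card S) \<le> real n" by simp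
    qed simp
    finally show "(\<Sum>U\<in>\<U>. b (card U)) \<le> real n * (1 / real n ^ A)" .
  qed
  finally show ?thesis by (simp add: \<U>_def)
qed

text \<open>The case \<open>t = -1/2\<close>, admissible since \<open>k \<ge> 1\<close>. The form
  \<open>exp (ln (n / k) / 2)\<close> is chosen to cancel against \<open>exp (- a / 2)\<close> in
  the expectation.\<close>

lemma exp_half_conn_cost_le:
  assumes "1 \<le> k" "k < n"
  shows "(\<integral>\<^sup>+w. ennreal (exp (conn_cost n w {1..k} / 2)) \<partial>weight_space n)
    \<le> ennreal (2 * exp (ln (real n / real k) / 2))"
proof -
  have "(\<integral>\<^sup>+w. ennreal (exp (- (- 1/2) * conn_cost n w {1..k})) \<partial>weight_space n)
      \<le> ennreal (\<Prod>i\<in>{card {1..k}..<n}. real i / (real i + (- 1/2)))"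
    using assms by (intro exp_moment_conn_cost) auto
  also have "\<dots> \<le> ennreal (2 * sqrt (real n / real k))"
    using prod_half_le_sqrt[OF assms] by (intro ennreal_leI) simp
  also have "sqrt (real n / real k) = exp (ln (real n / real k) / 2)"
    using assms by (simp add: ln_sqrt[symmetric])
  finally show ?thesis by simp
qed

text \<open>One bound, linear in \<open>Y\<close> and \<open>S\<close>, covers both typical and
  exceptional weights, so that taking expectations requires only the two moment estimates and no
  conditioning.\<close>

lemma alg_opt_ratio_pointwise:
  fixes \<epsilon> :: real and n C q :: nat
  assumes pos: "\<And>i. 1 \<le> i \<Longrightarrow> i \<le> n \<Longrightarrow> f i > 0"
    and mono: "\<And>i j. 1 \<le> i \<Longrightarrow> i \<le> j \<Longrightarrow> j \<le> n \<Longrightarrow> f i \<le> f j"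
    and kn: "kappa n f < n" and w: "\<forall>e\<in>edges n. 0 \<le> w e"
    and ratio: "f n / f 1 \<le> real n ^ q"
    and \<epsilon>: "0 < \<epsilon>" "\<epsilon> < 1/2" and K: "1 \<le> K" and b: "0 < b"
    and small: "real (kappa n f) \<le> exp (- K / \<epsilon>) * real n"
  defines "a \<equiv> ln (real n / real (kappa n f))"
    and "Y \<equiv> exp (conn_cost n w {1..kappa n f} / 2)"
    and "S \<equiv> (\<Sum>U | U \<subseteq> {1..n} \<and> U \<noteq> {} \<and> real (card U) \<le> exp (- K) * real n.
      exp (real (C * card U) * ((1 - \<epsilon>) * ln (real n / real (card U)) - conn_cost n w U)))"
  shows "fl_alg n f w / fl_opt n f w \<le>
    1 / (1 - 2 * \<epsilon>) + (2 * \<epsilon> * exp (- a / 2) / (1 - 2 * \<epsilon>) + 4 * real n ^ (q + 1) / b) * Y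
      + 4 * real n ^ (q + 1) * b * S"
proof -
  define k where "k = kappa n f"
  define D where "D = conn_cost n w {1..k}"
  define F where "F = (\<Sum>i=1..k. f i)"
  have k: "1 \<le> k" "k < n" using kappa_in[of n f] kn by (auto simp: k_def)
  have D0: "0 \<le> D" unfolding D_def using k by (intro conn_cost_nonneg w) auto
  have F0: "0 \<le> F" unfolding F_def using pos k by (intro sum_nonneg) (auto intro: less_imp_le)
  have S0: "0 \<le> S" unfolding S_def by (intro sum_nonneg) auto
  have Y: "Y = exp (D / 2)" by (simp add: Y_def D_def k_def)
  have ineq: "exp (K / \<epsilon>) \<le> real n / real k"
    using small k by (simp add: k_def exp_minus field_simps)
  then have "K / \<epsilon> \<le> a" using k by (simp add: a_def k_def ln_ge_iff)
  \<comment> \<open>This is why smallness is required with \<open>K / \<epsilon>\<close>: the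
    additive loss \<open>K\<close> becomes a fraction \<epsilon> of \<open>a\<close>.\<close>
  then have Ka: "K \<le> \<epsilon> * a" using \<epsilon> by (simp add: field_simps)
  have a1: "1 \<le> \<epsilon> * a" using Ka K by simp
  then have a0: "0 < a" using \<epsilon> by (metis not_one_le_zero mult_le_0_iff less_le_not_le not_less order_trans)
  have alg: "fl_alg n f w = F + D" by (simp add: fl_alg_def fl_cost_conn k_def D_def F_def)
  show ?thesis
  proof (cases "\<forall>U. U \<subseteq> {1..n} \<and> U \<noteq> {} \<and> real (card U) \<le> exp (- K) * real n \<longrightarrow>
       (1 - \<epsilon>) * ln (real n / real (card U)) \<le> conn_cost n w U")
    case True
    have "K \<le> K / \<epsilon>" using K \<epsilon> by (simp add: field_simps)
    then have small': "real (kappa n f) \<le> exp (- K) * real n"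
      using small by (smt (verit) exp_le_cancel_iff mult_right_mono of_nat_0_le_iff minus_divide_left)
    have "F + (1 - \<epsilon>) * a - K \<le> fl_opt n f w"
      unfolding F_def k_def a_def using True \<epsilon> K pos mono small'
      by (intro fl_opt_ge[OF _ _ kn w, where \<delta> = "exp (- K)"]) auto
    moreover have "(1 - 2 * \<epsilon>) * (F + a) \<le> F + (1 - \<epsilon>) * a - K"
    proof -
      have "(1 - 2 * \<epsilon>) * (F + a) = F + (1 - \<epsilon>) * a - 2 * (\<epsilon> * F) - \<epsilon> * a" by (simp add: algebra_simps)
      moreover have "0 \<le> \<epsilon> * F" using F0 \<epsilon> by simp
      ultimately show ?thesis using Ka by linarith
    qed
    ultimately have opt: "(1 - 2 * \<epsilon>) * (F + a) \<le> fl_opt n f w" by linarith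
    have M: "0 < (1 - 2 * \<epsilon>) * (F + a)" using F0 a0 \<epsilon> by simp
    \<comment> \<open>The excess of \<open>D\<close> over its typical size \<open>a\<close> is
      controlled by the exponential moment, through \<open>x \<le> exp x\<close>.\<close>
    have "(D - a) / 2 \<le> exp ((D - a) / 2)"
      using exp_ge_add_one_self[of "(D - a) / 2"] by linarith
    also have "\<dots> = exp (- a / 2) * Y" by (simp add: Y exp_add[symmetric] diff_divide_distrib)
    finally have D: "D \<le> a + 2 * (exp (- a / 2) * Y)" by simp
    have "fl_alg n f w / fl_opt n f w \<le> (F + a + 2 * (exp (- a / 2) * Y)) / ((1 - 2 * \<epsilon>) * (F + a))"
      unfolding alg using opt M D F0 D0 by (intro frac_le) auto
    also have "\<dots> = 1 / (1 - 2 * \<epsilon>) + (1 / (F + a)) * (2 * (exp (- a / 2) * Y) / (1 - 2 * \<epsilon>))"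
    proof -
      have "(M + X) / (e * M) = 1 / e + (1 / M) * (X / e)" if "M \<noteq> 0" "e \<noteq> 0" for M X e :: real
        using that by (simp add: field_simps)
      from this[of "F + a" "1 - 2 * \<epsilon>"] show ?thesis using F0 a0 \<epsilon> by simp
    qed
    also have "\<dots> \<le> 1 / (1 - 2 * \<epsilon>) + \<epsilon> * (2 * (exp (- a / 2) * Y) / (1 - 2 * \<epsilon>))"
    proof (intro add_left_mono mult_right_mono)
      have "1 \<le> \<epsilon> * (F + a)" 
        using a1 mult_nonneg_nonneg[of \<epsilon> F] F0 \<epsilon>(1) unfolding distrib_left by linarith
      then show "1 / (F + a) \<le> \<epsilon>" using F0 a0 by (simp add: field_simps)
      show "0 \<le> 2 * (exp (- a / 2) * Y) / (1 - 2 * \<epsilon>)" using \<epsilon> by (simp add: Y)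
    qed
    also have "\<dots> = 1 / (1 - 2 * \<epsilon>) + 2 * \<epsilon> * exp (- a / 2) / (1 - 2 * \<epsilon>) * Y" by simp
    also have "\<dots> \<le> 1 / (1 - 2 * \<epsilon>) + (2 * \<epsilon> * exp (- a / 2) / (1 - 2 * \<epsilon>) + 4 * real n ^ (q + 1) / b) * Y"
      using b by (intro add_left_mono mult_right_mono) (auto simp: Y)
    also have "\<dots> \<le> \<dots> + 4 * real n ^ (q + 1) * b * S" using b S0 by simp
    finally show ?thesis .
  next
    case False
    then obtain U where U: "U \<subseteq> {1..n}" "U \<noteq> {}" "real (card U) \<le> exp (- K) * real n"
      "\<not> (1 - \<epsilon>) * ln (real n / real (card U)) \<le> conn_cost n w U" by blast
    \<comment> \<open>A violating set has a nonnegative exponent, so its term alone makes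
      \<open>S\<close> at least 1.\<close>
    have "1 \<le> exp (real (C * card U) * ((1 - \<epsilon>) * ln (real n / real (card U)) - conn_cost n w U))"
      using U by (intro one_le_exp_iff[THEN iffD2] mult_nonneg_nonneg) auto
    also have "\<dots> \<le> S" unfolding S_def
    proof (rule member_le_sum)
      show "finite {U. U \<subseteq> {1..n} \<and> U \<noteq> {} \<and> real (card U) \<le> exp (- K) * real n}"
        by (rule finite_subset[of _ "Pow {1..n}"]) auto
    qed (use U in auto)
    finally have S1: "1 \<le> S" .
    \<comment> \<open>The square root of \<open>Y\<close>, which still dominates
      \<open>1 + D\<close> up to the factor 4. The elementary inequality
      \<open>z * b \<le> z^2 + b^2\<close> then separates the size of \<open>D\<close> from the
      rarity of the event, in place of the Cauchy-Schwarz inequality.\<close>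
    define z where "z = exp (D / 4)"
    have Yz: "Y = z\<^sup>2" by (simp add: Y z_def power2_eq_square exp_add[symmetric])
    have "0 \<le> (z - b)\<^sup>2 + z * b" using b by (simp add: z_def)
    then have "z * b \<le> z\<^sup>2 + b\<^sup>2" by (simp add: power2_eq_square algebra_simps)
    then have "z \<le> Y / b + b" using b by (simp add: Yz field_simps power2_eq_square)
    also have "\<dots> \<le> Y / b + b * S" using S1 b by simp
    finally have zb: "z \<le> Y / b + b * S" .
    have Dz: "1 + D \<le> 4 * z" unfolding z_def using exp_ge_add_one_self[of "D / 4"] by linarith
    have "fl_alg n f w / fl_opt n f w \<le> real n ^ (q + 1) * (1 + D)"
      unfolding D_def k_def using pos mono by (intro alg_opt_ratio_le[OF _ _ kn w ratio]) auto
    also have "\<dots> \<le> real n ^ (q + 1) * (4 * z)"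
      using Dz by (intro mult_left_mono) auto
    also have "\<dots> \<le> real n ^ (q + 1) * (4 * (Y / b + b * S))"
      using zb by (intro mult_left_mono) auto
    also have "\<dots> = 4 * real n ^ (q + 1) / b * Y + 4 * real n ^ (q + 1) * b * S"
      by (simp add: algebra_simps)
    also have "\<dots> \<le> 1 / (1 - 2 * \<epsilon>) + (2 * \<epsilon> * exp (- a / 2) / (1 - 2 * \<epsilon>) + 4 * real n ^ (q + 1) / b) * Y
      + 4 * real n ^ (q + 1) * b * S"
      using \<epsilon> by (simp add: Y distrib_right)
    finally show ?thesis .
  qed
qed

lemma expected_ratio_le:
  fixes \<epsilon> :: real and n C q :: nat
  assumes pos: "\<And>i. 1 \<le> i \<Longrightarrow> i \<le> n \<Longrightarrow> f i > 0"
    and mono: "\<And>i j. 1 \<le> i \<Longrightarrow> i \<le> j \<Longrightarrow> j \<le> n \<Longrightarrow> f i \<le> f j"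
    and kn: "kappa n f < n"
    and ratio: "f n / f 1 \<le> real n ^ q"
    and \<epsilon>: "0 < \<epsilon>" "\<epsilon> < 1/2"
    and C: "real (2 * q + 6) + 2 \<le> real C * \<epsilon>"
    and K: "K = real C * ln (1 + real C) + 1"
    and small: "real (kappa n f) \<le> exp (- K / \<epsilon>) * real n"
  shows "(\<integral>\<^sup>+w. ennreal (fl_alg n f w / fl_opt n f w) \<partial>weight_space n)
    \<le> ennreal ((1 + 4 * \<epsilon>) / (1 - 2 * \<epsilon>) + 12 / real n)"
proof -
  define k where "k = kappa n f"
  define a where "a = ln (real n / real k)"
  \<comment> \<open>Balances the exceptional terms: dividing by \<open>b\<close> leaves at most
    \<open>8 / n\<close> from \<open>Y\<close>, and multiplying by \<open>b\<close> leaves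
    \<open>4 / n\<close> from \<open>S\<close>, whose expectation is at most
    \<open>n / n ^ (2 * q + 6)\<close>.\<close>
  define b where "b = real n ^ (q + 3)"
  define c0 where "c0 = 1 / (1 - 2 * \<epsilon>)"
  define c1 where "c1 = 2 * \<epsilon> * exp (- a / 2) / (1 - 2 * \<epsilon>) + 4 * real n ^ (q + 1) / b"
  define c2 where "c2 = 4 * real n ^ (q + 1) * b"
  define Y where "Y w = exp (conn_cost n w {1..k} / 2)" for w
  define \<U> where "\<U> = {U. U \<subseteq> {1..n} \<and> U \<noteq> {} \<and> real (card U) \<le> exp (- K) * real n}"
  define S where "S w = (\<Sum>U\<in>\<U>.
      exp (real (C * card U) * ((1 - \<epsilon>) * ln (real n / real (card U)) - conn_cost n w U)))" for w
  have k: "1 \<le> k" "k < n" using kappa_in[of n f] kn by (auto simp: k_def)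
  have n: "1 \<le> real n" "0 < real n" using k by auto
  have b: "0 < b" using n by (simp add: b_def)
  have K1: "1 \<le> K" by (simp add: K)
  have c: "0 \<le> c0" "0 \<le> c1" "0 \<le> c2" using \<epsilon> b by (auto simp: c0_def c1_def c2_def)
  have [measurable]: "Y \<in> borel_measurable (weight_space n)"
    unfolding Y_def using measurable_conn_cost[of "{1..k}" n] k by (simp add: subset_eq)
  have [measurable]: "S \<in> borel_measurable (weight_space n)"
    unfolding S_def
  proof (rule borel_measurable_sum)
    fix U assume "U \<in> \<U>"
    then have [measurable]: "(\<lambda>w. conn_cost n w U) \<in> borel_measurable (weight_space n)"
      by (intro measurable_conn_cost) (auto simp: \<U>_def)
    show "(\<lambda>w. exp (real (C * card U) *
        ((1 - \<epsilon>) * ln (real n / real (card U)) - conn_cost n w U))) \<in> borel_measurable (weight_space n)"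
      by measurable
  qed
  have nonneg: "0 \<le> Y w" "0 \<le> S w" for w by (auto simp: Y_def S_def intro!: sum_nonneg)
  have EY: "(\<integral>\<^sup>+w. ennreal (Y w) \<partial>weight_space n) \<le> ennreal (2 * exp (a / 2))"
    unfolding Y_def a_def by (rule exp_half_conn_cost_le[OF k])
  have ES: "(\<integral>\<^sup>+w. ennreal (S w) \<partial>weight_space n) \<le> ennreal (real n * (1 / real n ^ (2 * q + 6)))"
    unfolding S_def \<U>_def using k by (intro chernoff_union_bound[OF _ C K]) auto
  have "(\<integral>\<^sup>+w. ennreal (fl_alg n f w / fl_opt n f w) \<partial>weight_space n)
      \<le> (\<integral>\<^sup>+w. ennreal c0 + ennreal c1 * ennreal (Y w) + ennreal c2 * ennreal (S w) \<partial>weight_space n)"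
  proof (rule nn_integral_mono_AE, use AE_weights_nonneg in eventually_elim)
    fix w :: "nat \<times> nat \<Rightarrow> real" assume w: "\<forall>e\<in>edges n. 0 \<le> w e"
    have "fl_alg n f w / fl_opt n f w \<le> c0 + c1 * Y w + c2 * S w"
      unfolding c0_def c1_def c2_def Y_def S_def \<U>_def a_def k_def using pos mono
      by (intro alg_opt_ratio_pointwise[OF _ _ kn w ratio \<epsilon> K1 b small]) auto
    then have "ennreal (fl_alg n f w / fl_opt n f w) \<le> ennreal (c0 + c1 * Y w + c2 * S w)"
      by (rule ennreal_leI)
    also have "\<dots> = ennreal c0 + ennreal c1 * ennreal (Y w) + ennreal c2 * ennreal (S w)"
      using c nonneg by (simp add: ennreal_mult)
    finally show "ennreal (fl_alg n f w / fl_opt n f w)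
        \<le> ennreal c0 + ennreal c1 * ennreal (Y w) + ennreal c2 * ennreal (S w)" .
  qed
  also have "\<dots> = ennreal c0 + ennreal c1 * (\<integral>\<^sup>+w. ennreal (Y w) \<partial>weight_space n)
      + ennreal c2 * (\<integral>\<^sup>+w. ennreal (S w) \<partial>weight_space n)"
    using prob_space.emeasure_space_1[OF prob_space_weight_space[of n]]
    by (simp add: nn_integral_add nn_integral_cmult)
  also have "\<dots> \<le> ennreal c0 + ennreal c1 * ennreal (2 * exp (a / 2))
      + ennreal c2 * ennreal (real n * (1 / real n ^ (2 * q + 6)))"
    using EY ES by (intro add_mono mult_left_mono) auto
  also have "\<dots> = ennreal (c0 + c1 * (2 * exp (a / 2)) + c2 * (real n * (1 / real n ^ (2 * q + 6))))"
  proof -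
    have lin: "ennreal c0 + ennreal c1 * ennreal y + ennreal c2 * ennreal z = ennreal (c0 + c1 * y + c2 * z)"
      if "0 \<le> y" "0 \<le> z" for y z using c that by (simp add: ennreal_mult)
    show ?thesis by (rule lin) auto
  qed
  also have "\<dots> \<le> ennreal ((1 + 4 * \<epsilon>) / (1 - 2 * \<epsilon>) + 12 / real n)"
  proof (rule ennreal_leI)
    have "exp (a / 2) = sqrt (real n / real k)"
      using k by (simp add: a_def ln_sqrt[symmetric])
    also have "\<dots> \<le> sqrt (real n)" using k by (simp add: field_simps)
    also have "\<dots> \<le> real n" using n by (simp add: sqrt_le_D real_le_lsqrt self_le_power power2_eq_square)
    finally have ea: "exp (a / 2) \<le> real n" .
    have "4 * real n ^ (q + 1) / b * (2 * exp (a / 2)) \<le> 4 * real n ^ (q + 1) / b * (2 * real n)"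
      using ea b by (intro mult_left_mono) auto
    also have "\<dots> = 8 / real n" using n by (simp add: b_def power_add field_simps power3_eq_cube)
    finally have t1: "4 * real n ^ (q + 1) / b * (2 * exp (a / 2)) \<le> 8 / real n" .
    have "2 * \<epsilon> * exp (- a / 2) / (1 - 2 * \<epsilon>) * (2 * exp (a / 2)) = 4 * \<epsilon> / (1 - 2 * \<epsilon>) * (exp (- a / 2) * exp (a / 2))"
      by simp
    also have "\<dots> = 4 * \<epsilon> / (1 - 2 * \<epsilon>)" by (simp add: exp_add[symmetric])
    finally have t2: "c1 * (2 * exp (a / 2)) \<le> 4 * \<epsilon> / (1 - 2 * \<epsilon>) + 8 / real n"
      using t1 unfolding c1_def distrib_right by linarith
    have "real n ^ (2 * q + 6) = real n ^ (q + 1) * real n ^ (q + 3) * (real n * real n)"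
      by (simp add: power_add[symmetric] power2_eq_square[symmetric] add.commute del: power_Suc)
    then have t3: "c2 * (real n * (1 / real n ^ (2 * q + 6))) = 4 / real n"
      using n by (simp add: c2_def b_def)
    have "c0 + c1 * (2 * exp (a / 2)) + c2 * (real n * (1 / real n ^ (2 * q + 6)))
        \<le> c0 + (4 * \<epsilon> / (1 - 2 * \<epsilon>) + 8 / real n) + 4 / real n"
      using t2 t3 by simp
    also have "\<dots> = (1 + 4 * \<epsilon>) / (1 - 2 * \<epsilon>) + 12 / real n"
      by (simp add: c0_def add_divide_distrib)
    finally show "c0 + c1 * (2 * exp (a / 2)) + c2 * (real n * (1 / real n ^ (2 * q + 6)))
        \<le> (1 + 4 * \<epsilon>) / (1 - 2 * \<epsilon>) + 12 / real n" .
  qed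
  finally show ?thesis .
qed

text \<open>The optimum is at most \<open>ALG\<close> and, almost surely, at least
  \<open>f 1 > 0\<close>; positivity rules out the default value 0 of a division by zero.\<close>

lemma expected_ratio_ge_1:
  assumes pos: "\<And>i. 1 \<le> i \<Longrightarrow> i \<le> n \<Longrightarrow> f i > 0"
    and mono: "\<And>i j. 1 \<le> i \<Longrightarrow> i \<le> j \<Longrightarrow> j \<le> n \<Longrightarrow> f i \<le> f j" and n: "1 \<le> n"
  shows "1 \<le> (\<integral>\<^sup>+w. ennreal (fl_alg n f w / fl_opt n f w) \<partial>weight_space n)"
proof -
  have "1 = (\<integral>\<^sup>+w. 1 \<partial>weight_space n)"
    using prob_space.emeasure_space_1[OF prob_space_weight_space[of n]] by simp
  also have "\<dots> \<le> (\<integral>\<^sup>+w. ennreal (fl_alg n f w / fl_opt n f w) \<partial>weight_space n)"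
  proof (rule nn_integral_mono_AE, use AE_weights_nonneg in eventually_elim)
    fix w :: "nat \<times> nat \<Rightarrow> real" assume w: "\<forall>e\<in>edges n. 0 \<le> w e"
    have "f 1 \<le> fl_opt n f w" using pos mono by (intro fl_opt_ge_cheapest[OF _ _ n w]) auto
    then have "0 < fl_opt n f w" using pos[of 1] n by simp
    then have "1 \<le> fl_alg n f w / fl_opt n f w" using fl_opt_le_alg[OF n, of f w] by simp
    then show "1 \<le> ennreal (fl_alg n f w / fl_opt n f w)" by simp
  qed
  finally show ?thesis .
qed

theorem theorem1:
  fixes f :: "nat \<Rightarrow> nat \<Rightarrow> real"
  assumes pos: "\<And>n i. 1 \<le> i \<Longrightarrow> i \<le> n \<Longrightarrow> f n i > 0"
    and mono: "\<And>n i j. 1 \<le> i \<Longrightarrow> i \<le> j \<Longrightarrow> j \<le> n \<Longrightarrow> f n i \<le> f n j"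
    and ratio: "\<exists>q::real. \<forall>n\<ge>1. f n n / f n 1 \<le> real n powr q"
    and kappa_small: "(\<lambda>n. real (kappa n (f n))) \<in> o(\<lambda>n. real n)"
  shows "(\<lambda>n. \<integral>\<^sup>+ w. ennreal (fl_alg n (f n) w / fl_opt n (f n) w) \<partial>weight_space n)
           \<longlonglongrightarrow> 1"
proof (rule order_tendstoI)
  fix x :: ennreal assume "x < 1"
  show "eventually (\<lambda>n. x < (\<integral>\<^sup>+ w. ennreal (fl_alg n (f n) w / fl_opt n (f n) w) \<partial>weight_space n)) sequentially"
    using eventually_ge_at_top[of "1::nat"]
  proof eventually_elim
    case (elim n)
    have "1 \<le> (\<integral>\<^sup>+ w. ennreal (fl_alg n (f n) w / fl_opt n (f n) w) \<partial>weight_space n)"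
      using elim pos mono by (intro expected_ratio_ge_1) auto
    then show ?case using \<open>x < 1\<close> by (rule less_le_trans[rotated])
  qed
next
  fix x :: ennreal assume x: "1 < x"
  obtain q0 :: real where q0: "\<And>n. n \<ge> 1 \<Longrightarrow> f n n / f n 1 \<le> real n powr q0" using ratio by auto
  define q where "q = nat \<lceil>q0\<rceil>"
  have q: "f n n / f n 1 \<le> real n ^ q" if "n \<ge> 1" for n
  proof -
    have "real n powr q0 \<le> real n powr real q"
      using that by (intro powr_mono) (auto simp: q_def real_nat_ceiling_ge)
    then show ?thesis using q0[OF that] that by (simp add: powr_realpow)
  qed
  \<comment> \<open>The bound on the expectation tends to 1 as \<epsilon> tends to 0, so some
    admissible \<epsilon> brings it below \<open>x\<close>. The last summand \<epsilon> makes room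
    for \<open>12 / n\<close>.\<close>
  have "((\<lambda>\<epsilon>::real. ennreal ((1 + 4 * \<epsilon>) / (1 - 2 * \<epsilon>) + \<epsilon>)) \<longlongrightarrow> ennreal ((1 + 4 * 0) / (1 - 2 * 0) + 0)) (at_right 0)"
    by (intro tendsto_intros) auto
  then have "eventually (\<lambda>\<epsilon>. ennreal ((1 + 4 * \<epsilon>) / (1 - 2 * \<epsilon>) + \<epsilon>) < x) (at_right (0::real))"
    using x by (intro order_tendstoD) auto
  moreover have "eventually (\<lambda>\<epsilon>::real. \<epsilon> < 1/2) (at_right 0)"
    by (auto simp: eventually_at_right_field intro!: exI[of _ "1/2"])
  moreover have "eventually (\<lambda>\<epsilon>::real. 0 < \<epsilon>) (at_right 0)" by (rule eventually_at_right_less)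
  ultimately have "eventually (\<lambda>\<epsilon>. ennreal ((1 + 4 * \<epsilon>) / (1 - 2 * \<epsilon>) + \<epsilon>) < x \<and> \<epsilon> < 1/2 \<and> 0 < \<epsilon>)
      (at_right (0::real))" by eventually_elim auto
  then obtain \<epsilon> :: real where \<epsilon>x: "ennreal ((1 + 4 * \<epsilon>) / (1 - 2 * \<epsilon>) + \<epsilon>) < x"
    and \<epsilon>: "0 < \<epsilon>" "\<epsilon> < 1/2"
    using eventually_happens'[OF trivial_limit_at_right_real] by blast
  define C where "C = nat \<lceil>(real (2 * q + 6) + 2) / \<epsilon>\<rceil>"
  define K where "K = real C * ln (1 + real C) + 1"
  have C: "real (2 * q + 6) + 2 \<le> real C * \<epsilon>"
    using real_nat_ceiling_ge[of "(real (2 * q + 6) + 2) / \<epsilon>"]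
    unfolding C_def[symmetric] pos_divide_le_eq[OF \<epsilon>(1)] .
  \<comment> \<open>With \<epsilon>, \<open>C\<close> and \<open>K\<close> fixed independently of
    \<open>n\<close>, the assumption on \<open>kappa\<close> is used twice: for this threshold, and
    with the constant 1/2 to obtain \<open>kappa < n\<close>.\<close>
  have "eventually (\<lambda>n. norm (real (kappa n (f n))) \<le> exp (- K / \<epsilon>) * norm (real n)) sequentially"
    using kappa_small by (rule landau_o.smallD) simp
  moreover have "eventually (\<lambda>n. norm (real (kappa n (f n))) \<le> 1/2 * norm (real n)) sequentially"
    using kappa_small by (rule landau_o.smallD) simp
  moreover have "eventually (\<lambda>n. 12 / \<epsilon> \<le> real n) sequentially"
    using eventually_ge_at_top[of "nat \<lceil>12 / \<epsilon>\<rceil>"] by eventually_elim linarith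
  ultimately show "eventually (\<lambda>n. (\<integral>\<^sup>+ w. ennreal (fl_alg n (f n) w / fl_opt n (f n) w) \<partial>weight_space n) < x) sequentially"
    using eventually_ge_at_top[of "1::nat"]
  proof eventually_elim
    case (elim n)
    have kn: "kappa n (f n) < n" using elim by simp
    have small: "real (kappa n (f n)) \<le> exp (- K / \<epsilon>) * real n" using elim by simp
    have "(\<integral>\<^sup>+ w. ennreal (fl_alg n (f n) w / fl_opt n (f n) w) \<partial>weight_space n)
        \<le> ennreal ((1 + 4 * \<epsilon>) / (1 - 2 * \<epsilon>) + 12 / real n)"
      using pos mono q elim by (intro expected_ratio_le[OF _ _ kn _ \<epsilon> C K_def small]) auto
    also have "\<dots> \<le> ennreal ((1 + 4 * \<epsilon>) / (1 - 2 * \<epsilon>) + \<epsilon>)"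
      using elim \<epsilon> by (intro ennreal_leI add_left_mono) (auto simp: field_simps)
    finally show ?case using \<epsilon>x by (rule le_less_trans)
  qed
qed

end
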